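(* Let $(G_n)$ be a sequence of graphs, $G_n$ having $n$ vertices, average degree $d$, minimum degree $\delta$ and maximum degree $\Delta$ (all depending on $n$), and let $\lambda=\lambda(n)>0$ be such that every nontrivial adjacency eigenvalue of $G_n$ has absolute value at most $\lambda$, i.e. $|\lambda_i|\le\lambda$ for $i=2,\dots,n$, where $\lambda_1\ge\dots\ge\lambda_n$ are the adjacency eigenvalues. Suppose: (1) $\Delta-\delta\le R\lambda$ for some constant $R>0$; (2) $\frac{d}{\lambda}/\log^2 n\to\infty$; (3) $\log d\cdot\log\frac{d}{\lambda}\,/\log n\to\infty$. Then the number of Hamilton cycles in $G_n$ is $n!\left(\frac{d}{n}\right)^n(1+o(1))^n$.
   Context: "The number is $n!(d/n)^n(1+o(1))^n$" means there is a function $\varepsilon(n)\to0$ such that the number of Hamilton cycles lies between $n!(d/n)^n(1-\varepsilon(n))^n$ and $n!(d/n)^n(1+\varepsilon(n))^n$. *)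

theory Defs
  imports "HOL-Analysis.Analysis" "Jordan_Normal_Form.Char_Poly"
begin

definition simple_graph_on :: "nat \<Rightarrow> (nat \<Rightarrow> nat \<Rightarrow> bool) \<Rightarrow> bool" where
  "simple_graph_on n G \<longleftrightarrow>
     (\<forall>i j. G i j \<longrightarrow> i < n \<and> j < n) \<and> (\<forall>i j. G i j \<longrightarrow> G j i) \<and> (\<forall>i. \<not> G i i)"

definition degree_of :: "nat \<Rightarrow> (nat \<Rightarrow> nat \<Rightarrow> bool) \<Rightarrow> nat \<Rightarrow> nat" where
  "degree_of n G i = card {j. j < n \<and> G i j}"

definition avg_degree :: "nat \<Rightarrow> (nat \<Rightarrow> nat \<Rightarrow> bool) \<Rightarrow> real" where
  "avg_degree n G = (\<Sum>i<n. real (degree_of n G i)) / real n"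

definition min_degree :: "nat \<Rightarrow> (nat \<Rightarrow> nat \<Rightarrow> bool) \<Rightarrow> nat" where
  "min_degree n G = Min (degree_of n G ` {..<n})"

definition max_degree :: "nat \<Rightarrow> (nat \<Rightarrow> nat \<Rightarrow> bool) \<Rightarrow> nat" where
  "max_degree n G = Max (degree_of n G ` {..<n})"

definition adj_matrix :: "nat \<Rightarrow> (nat \<Rightarrow> nat \<Rightarrow> bool) \<Rightarrow> real mat" where
  "adj_matrix n G = mat n n (\<lambda>(i, j). if G i j then 1 else 0)"

text \<open>Adjacency eigenvalues with multiplicity: the roots of the characteristic polynomial
  (all real, since the adjacency matrix is real symmetric).\<close>
definition adj_eigenvalues :: "nat \<Rightarrow> (nat \<Rightarrow> nat \<Rightarrow> bool) \<Rightarrow> real multiset" where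
  "adj_eigenvalues n G = proots (char_poly (adj_matrix n G))"

definition nontrivial_eigenvalues :: "nat \<Rightarrow> (nat \<Rightarrow> nat \<Rightarrow> bool) \<Rightarrow> real multiset" where
  "nontrivial_eigenvalues n G =
     adj_eigenvalues n G - {# Max_mset (adj_eigenvalues n G) #}"

definition hamilton_cycles :: "nat \<Rightarrow> (nat \<Rightarrow> nat \<Rightarrow> bool) \<Rightarrow> nat set set set" where
  "hamilton_cycles n G =
     {C. \<exists>v. bij_betw v {..<n} {..<n} \<and> (\<forall>i<n. G (v i) (v ((i + 1) mod n))) \<and>
            C = (\<lambda>i. {v i, v ((i + 1) mod n)}) ` {..<n}}"

definition num_hamilton_cycles :: "nat \<Rightarrow> (nat \<Rightarrow> nat \<Rightarrow> bool) \<Rightarrow> nat" where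
  "num_hamilton_cycles n G = card (hamilton_cycles n G)"

end

theory Submission
  imports Defs "Jordan_Normal_Form.Spectral_Radius" "HOL-Real_Asymp.Real_Asymp"
begin

text \<open>
  The spectral hypotheses give a mixing estimate: the number of edges between \<open>X\<close> and \<open>Y\<close> is
  \<open>d |X| |Y| / n\<close> up to \<open>\<mu> sqrt (|X| |Y|)\<close> with \<open>\<mu> = O(\<lambda>)\<close>.

  A Hamilton cycle is in particular a bijection of the vertices along edges.  Building such bijections
  one value at a time, always serving the row with the fewest free columns, leaves by mixing at most
  \<open>d j / n + \<mu>\<close> choices when \<open>j\<close> rows remain; the product is \<open>n! (d/n)^n (1 + o(1))^n\<close>.

  For the lower bound, start with \<open>n\<close> one-vertex paths and repeatedly join the end of the path with the
  most available continuations to the start of another path.  With \<open>j\<close> paths present there are at least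
  \<open>d j / n - \<mu> - 1\<close> choices, and stopping at \<open>k\<close> paths loses only a factor \<open>e^o(n)\<close>, where
  \<open>k log^2 n = o(n)\<close>.  Concatenating the \<open>k\<close> paths gives a Hamilton path with fewer than \<open>k\<close> non-edges.  Each
  non-edge can be removed by \<open>O(log n)\<close> Posa rotations that use only edges of the graph.  A rotation
  reverses a suffix of the list of vertices, so it is undone knowing one number at most \<open>n\<close>; hence at most
  \<open>n^O(k log n) = e^o(n)\<close> path systems lead to the same Hamilton cycle.

  To close up a path, cut it into \<open>O(log n)\<close> segments.  Rotating freely at both ends moves the two end
  vertices to vertices with many neighbours in the core of every segment, and leaves two segments unbroken.
  Further rotations of each end inside a segment of its own are independent of each other and yield two
  large sets of possible ends, between which mixing provides an edge.
\<close>

section \<open>Paths, suffix reversals and rotations\<close>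

primrec adj :: "'a list \<Rightarrow> 'a \<Rightarrow> 'a \<Rightarrow> bool" where
  "adj [] x y \<longleftrightarrow> False"
| "adj (a # xs) x y \<longleftrightarrow> (xs \<noteq> [] \<and> x = a \<and> y = hd xs) \<or> adj xs x y"

definition nb :: "'a list \<Rightarrow> 'a \<Rightarrow> 'a set" where
  "nb xs x = {y. adj xs x y \<or> adj xs y x}"

lemma adj_append:
  "adj (u @ v) x y \<longleftrightarrow>
     adj u x y \<or> adj v x y \<or> (u \<noteq> [] \<and> v \<noteq> [] \<and> x = last u \<and> y = hd v)"
  by (induction u) (auto simp: hd_append)

lemma adj_rev: "adj (rev xs) x y \<longleftrightarrow> adj xs y x"
  by (induction xs) (auto simp: adj_append last_rev)

lemma adj_in_set: "adj xs x y \<Longrightarrow> x \<in> set xs \<and> y \<in> set xs"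
  by (induction xs) auto

lemma adj_right_unique: "distinct xs \<Longrightarrow> adj xs x y \<Longrightarrow> adj xs x z \<Longrightarrow> y = z"
  by (induction xs) (auto dest: adj_in_set)

lemma adj_left_unique: "distinct xs \<Longrightarrow> adj xs y x \<Longrightarrow> adj xs z x \<Longrightarrow> y = z"
  using adj_right_unique[of "rev xs" x y z] by (simp add: adj_rev)

lemma nb_sym: "y \<in> nb xs x \<longleftrightarrow> x \<in> nb xs y"
  by (auto simp: nb_def)

lemma nb_subset: "nb xs x \<subseteq> set xs"
  by (auto simp: nb_def dest: adj_in_set)

lemma nb_rev [simp]: "nb (rev xs) x = nb xs x"
  by (auto simp: nb_def adj_rev)

lemma nb_append:
  "nb (u @ v) x = nb u x \<union> nb v x \<union>
     (if u \<noteq> [] \<and> v \<noteq> [] \<and> x = last u then {hd v} else {}) \<union>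
     (if u \<noteq> [] \<and> v \<noteq> [] \<and> x = hd v then {last u} else {})"
  by (auto simp: nb_def adj_append)

lemma nb_outside: "x \<notin> set xs \<Longrightarrow> nb xs x = {}"
  by (auto simp: nb_def dest: adj_in_set)

lemma card_nb_le: assumes "distinct xs" shows "card (nb xs x) \<le> 2"
proof -
  \<comment> \<open>A missing successor or predecessor makes \<open>THE\<close> denote some
    arbitrary element, which can only enlarge this superset of at most two elements.\<close>
  have sub: "nb xs x \<subseteq> {THE y. adj xs x y, THE y. adj xs y x}"
    using adj_right_unique[OF assms] adj_left_unique[OF assms]
    by (auto simp: nb_def intro!: the_equality[symmetric])
  have "card (nb xs x) \<le> card {THE y. adj xs x y, THE y. adj xs y x}"
    by (rule card_mono[OF _ sub]) simp
  also have "\<dots> \<le> 2" by (simp add: card_insert_if)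
  finally show ?thesis .
qed

lemma card_UN_nb_le:
  assumes "distinct xs" "finite S" shows "card (\<Union>x\<in>S. nb xs x) \<le> 2 * card S"
proof -
  have "card (\<Union>x\<in>S. nb xs x) \<le> (\<Sum>x\<in>S. card (nb xs x))"
    by (rule card_UN_le[OF assms(2)])
  also have "\<dots> \<le> (\<Sum>x\<in>S. 2)" by (intro sum_mono card_nb_le assms)
  finally show ?thesis by simp
qed

text \<open>Only the two end vertices of a contiguous block can have path neighbours outside it. So
  the inside of a segment does not depend on the list around it.\<close>

lemma nb_middle:
  assumes "distinct (p @ C @ r)" "w \<in> set C" "w \<noteq> hd C" "w \<noteq> last C"
  shows "nb (p @ C @ r) w = nb C w"
proof -
  from assms have "w \<notin> set p" "w \<notin> set r" "C \<noteq> []" by auto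
  moreover have "p \<noteq> [] \<Longrightarrow> w \<noteq> last p" "r \<noteq> [] \<Longrightarrow> w \<noteq> hd r"
    using calculation by (auto dest: last_in_set hd_in_set)
  ultimately show ?thesis using assms by (auto simp: nb_append nb_outside)
qed

text \<open>A red pair is a consecutive pair that is not an edge of \<open>G\<close>. Concatenating
  paths creates such pairs only at the junctions, and rotations never add one.\<close>

fun red :: "('a \<Rightarrow> 'a \<Rightarrow> bool) \<Rightarrow> 'a list \<Rightarrow> nat" where
  "red G [] = 0"
| "red G [x] = 0"
| "red G (x # y # xs) = (if G x y then 0 else 1) + red G (y # xs)"

lemma red_Cons: "red G (x # xs) = red G xs + (if xs \<noteq> [] \<and> \<not> G x (hd xs) then 1 else 0)"
  by (cases xs) auto

lemma red_append:
  "red G (u @ v) = red G u + red G v + (if u \<noteq> [] \<and> v \<noteq> [] \<and> \<not> G (last u) (hd v) then 1 else 0)"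
  by (induction u) (auto simp: red_Cons hd_append)

lemma red_rev: "symp G \<Longrightarrow> red G (rev xs) = red G xs"
  by (induction xs) (auto simp: red_append red_Cons last_rev dest: sympD)

lemma red_eq_0_iff: "red G xs = 0 \<longleftrightarrow> successively G xs"
  by (induction G xs rule: red.induct) auto

lemma red_pos_split:
  "red G xs > 0 \<Longrightarrow> \<exists>u v. xs = u @ v \<and> u \<noteq> [] \<and> v \<noteq> [] \<and> \<not> G (last u) (hd v)"
proof (induction G xs rule: red.induct)
  case (3 G x y xs)
  show ?case
  proof (cases "G x y")
    case True
    then obtain u v where "y # xs = u @ v" "u \<noteq> []" "v \<noteq> []" "\<not> G (last u) (hd v)"
      using 3 by auto
    then show ?thesis by (intro exI[of _ "x # u"] exI[of _ v]) auto
  next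
    case False then show ?thesis by (intro exI[of _ "[x]"] exI[of _ "y # xs"]) auto
  qed
qed auto

text \<open>A rotation at the last vertex is a suffix reversal, and so is the reversal of the whole
  list, which exchanges the two ends. Recording only the number of reversals is enough for counting
  preimages.\<close>

definition suffix_rev :: "'a list \<Rightarrow> 'a list \<Rightarrow> bool" where
  "suffix_rev xs ys \<longleftrightarrow> (\<exists>u v. xs = u @ v \<and> ys = u @ rev v)"

lemma suffix_rev_perm:
  "suffix_rev xs ys \<Longrightarrow> mset ys = mset xs"
  by (auto simp: suffix_rev_def)

lemma suffix_rev_power_perm: "(suffix_rev ^^ t) xs ys \<Longrightarrow> mset ys = mset xs"
  by (induction t arbitrary: ys) (auto dest: suffix_rev_perm)

lemma suffix_rev_refl: "suffix_rev xs xs"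
  unfolding suffix_rev_def by (intro exI[of _ xs] exI[of _ "[]"]) simp

lemma suffix_rev_rev: "suffix_rev xs (rev xs)"
  unfolding suffix_rev_def by (intro exI[of _ xs] exI[of _ "[]"]) (metis append_Nil)

lemma suffix_rev_append: "suffix_rev xs ys \<Longrightarrow> suffix_rev (p @ xs) (p @ ys)"
  unfolding suffix_rev_def by (metis append.assoc)

lemma suffix_rev_power_append: "(suffix_rev ^^ t) xs ys \<Longrightarrow> (suffix_rev ^^ t) (p @ xs) (p @ ys)"
  by (induction t arbitrary: ys) (auto intro!: relcomppI suffix_rev_append)

lemma suffix_rev_power_trans:
  "(suffix_rev ^^ s) xs ys \<Longrightarrow> (suffix_rev ^^ t) ys zs \<Longrightarrow> (suffix_rev ^^ (s + t)) xs zs"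
  by (auto simp: relpowp_add)

lemma suffix_rev_power_mono:
  assumes "(suffix_rev ^^ s) xs ys" "s \<le> t" shows "(suffix_rev ^^ t) xs ys"
proof -
  have "(suffix_rev ^^ k) ys ys" for k :: nat
    by (induction k) (auto intro!: relcomppI suffix_rev_refl)
  from suffix_rev_power_trans[OF assms(1) this[of "t - s"]] assms(2) show ?thesis by simp
qed

text \<open>The three reversals lead to \<open>u @ rev v\<close>, \<open>v @ rev u\<close> and
  \<open>v @ u\<close>. The cyclic shift serves to reopen a closed list at a red pair.\<close>

lemma suffix_rev_power_rotate: "(suffix_rev ^^ 3) (u @ v) (v @ u)"
proof -
  have "suffix_rev (u @ v) (u @ rev v)" unfolding suffix_rev_def by blast
  moreover have "suffix_rev (u @ rev v) (v @ rev u)" using suffix_rev_rev[of "u @ rev v"] by simp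
  moreover have "suffix_rev (v @ rev u) (v @ u)" unfolding suffix_rev_def by (metis rev_rev_ident)
  ultimately show ?thesis by (auto simp: numeral_3_eq_3)
qed

text \<open>With the cut point known, a suffix reversal is its own inverse, so each step backwards
  has at most \<open>length ys + 1\<close> possibilities. Finiteness is carried along because the
  cardinality estimates need it.\<close>

lemma card_suffix_rev_power_preimage:
  "finite {xs. (suffix_rev ^^ t) xs ys} \<and>
   card {xs. (suffix_rev ^^ t) xs ys} \<le> (length ys + 1) ^ t"
proof (induction t)
  case 0 then show ?case by simp
next
  case (Suc t)
  let ?A = "{xs. (suffix_rev ^^ t) xs ys}"
  have sub: "{xs. (suffix_rev ^^ Suc t) xs ys} \<subseteq>
     (\<lambda>(j, zs). take j zs @ rev (drop j zs)) ` ({..length ys} \<times> ?A)"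
  proof
    fix xs assume "xs \<in> {xs. (suffix_rev ^^ Suc t) xs ys}"
    then have "(suffix_rev ^^ Suc t) xs ys" by simp
    from relpowp_Suc_D2[OF this] obtain zs where "suffix_rev xs zs" and zs: "(suffix_rev ^^ t) zs ys"
      by blast
    then obtain u v where uv: "xs = u @ v" "zs = u @ rev v" unfolding suffix_rev_def by blast
    have "length zs = length ys" using suffix_rev_power_perm[OF zs] by (metis size_mset)
    then show "xs \<in> (\<lambda>(j, zs). take j zs @ rev (drop j zs)) ` ({..length ys} \<times> ?A)"
      using uv zs by (intro image_eqI[of _ _ "(length u, zs)"]) auto
  qed
  have fin: "finite ({..length ys} \<times> ?A)" using Suc by blast
  have "card {xs. (suffix_rev ^^ Suc t) xs ys} \<le> card ({..length ys} \<times> ?A)"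
    by (rule order.trans[OF card_mono[OF finite_imageI[OF fin] sub] card_image_le[OF fin]])
  also have "\<dots> = (length ys + 1) * card ?A" by (simp add: card_cartesian_product)
  also have "\<dots> \<le> (length ys + 1) ^ Suc t"
    using mult_le_mono2[OF conjunct2[OF Suc], of "length ys + 1"] by simp
  finally show ?case using finite_subset[OF sub finite_imageI[OF fin]] by blast
qed

text \<open>Posa's rotations, with new ends confined to \<open>W\<close>.\<close>
primrec rotations :: "('a \<Rightarrow> 'a \<Rightarrow> bool) \<Rightarrow> 'a set \<Rightarrow> 'a list \<Rightarrow> nat \<Rightarrow> 'a list set" where
  "rotations G W xs 0 = {xs}"
| "rotations G W xs (Suc t) = rotations G W xs t \<union>
     {u @ rev v | u v. u \<noteq> [] \<and> v \<noteq> [] \<and> u @ v \<in> rotations G W xs t \<and> G (last u) (last v) \<and> hd v \<in> W}"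

definition ends :: "('a \<Rightarrow> 'a \<Rightarrow> bool) \<Rightarrow> 'a set \<Rightarrow> 'a list \<Rightarrow> nat \<Rightarrow> 'a set" where
  "ends G W xs t = last ` rotations G W xs t"

lemma ends_mono: "ends G W xs t \<subseteq> ends G W xs (Suc t)"
  by (auto simp: ends_def)

lemma rotations_suffix_rev: "ys \<in> rotations G W xs t \<Longrightarrow> (suffix_rev ^^ t) xs ys"
proof (induction t arbitrary: ys)
  case 0
  then show ?case by simp
next
  case (Suc t)
  from Suc.prems have "\<exists>zs \<in> rotations G W xs t. suffix_rev zs ys"
  proof (cases "ys \<in> rotations G W xs t")
    case True then show ?thesis using suffix_rev_refl by blast
  next
    case False
    with Suc.prems obtain u v where "ys = u @ rev v" "u @ v \<in> rotations G W xs t" by auto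
    then show ?thesis unfolding suffix_rev_def by blast
  qed
  with Suc.IH show ?case by auto
qed

text \<open>The prefix \<open>u\<close> is nonempty, so the first vertex stays put; the only new
  consecutive pair, \<open>last u\<close> and \<open>last v\<close>, is an edge, so no red pair
  appears.\<close>

lemma rotations_invariants:
  assumes "symp G" "ys \<in> rotations G W xs t" "xs \<noteq> []"
  shows "ys \<noteq> [] \<and> hd ys = hd xs \<and> red G ys \<le> red G xs \<and> last ys \<in> insert (last xs) W"
  using assms(2)
proof (induction t arbitrary: ys)
  case 0
  then show ?case using assms by simp
next
  case (Suc t)
  show ?case
  proof (cases "ys \<in> rotations G W xs t")
    case True then show ?thesis using Suc.IH by blast
  next
    case False
    with Suc.prems obtain u v where uv: "ys = u @ rev v" "u \<noteq> []" "v \<noteq> []"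
      "u @ v \<in> rotations G W xs t" "G (last u) (last v)" "hd v \<in> W" by auto
    have "red G (u @ rev v) \<le> red G (u @ v)"
      using uv assms(1) by (auto simp: red_append red_rev hd_rev)
    then show ?thesis using Suc.IH[OF uv(4)] uv by (auto simp: last_rev)
  qed
qed

text \<open>A rotation changes the path neighbours only of the old end, the new end and the pivot
  \<open>last u\<close>. The first two lie in \<open>ends\<close>; and if \<open>w\<close> were the
  pivot, one of its original neighbours would become an end.\<close>

lemma rotations_untouched:
  assumes "distinct xs" "ys \<in> rotations G W xs t" "w \<notin> ends G W xs t"
    "nb xs w \<inter> ends G W xs t = {}"
  shows "nb ys w = nb xs w"
  using assms(2-)
proof (induction t arbitrary: ys)
  case 0
  then show ?case by simp
next
  case (Suc t)
  have w: "w \<notin> ends G W xs t" "nb xs w \<inter> ends G W xs t = {}"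
    using Suc.prems ends_mono[of G W xs t] by auto
  show ?case
  proof (cases "ys \<in> rotations G W xs t")
    case True then show ?thesis using Suc.IH w by blast
  next
    case False
    with Suc.prems(1) obtain u v where uv: "ys = u @ rev v" "u \<noteq> []" "v \<noteq> []"
      "u @ v \<in> rotations G W xs t" "G (last u) (last v)" "hd v \<in> W" by auto
    have IH: "nb (u @ v) w = nb xs w" using Suc.IH[OF uv(4)] w by simp
    have "last v \<in> ends G W xs t" using uv unfolding ends_def by (metis imageI last_appendR)
    then have 1: "w \<noteq> last v" using w by auto
    have hd: "hd v \<in> ends G W xs (Suc t)"
      using Suc.prems(1) uv unfolding ends_def by (metis imageI last_appendR last_rev rev_is_Nil_conv)
    then have 2: "w \<noteq> hd v" using Suc.prems by auto
    have 3: "w \<noteq> last u"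
    proof
      assume "w = last u"
      then have "hd v \<in> nb (u @ v) w" using uv by (simp add: nb_append)
      then show False using IH hd Suc.prems(3) by auto
    qed
    show ?thesis using IH 1 2 3 uv by (simp add: nb_append hd_rev last_rev)
  qed
qed

text \<open>Posa's lemma. If \<open>w\<close> and its original neighbours avoid the ends, then
  \<open>w\<close> still has its original neighbours, so rotating with \<open>w\<close> as pivot
  makes one of them an end, a contradiction. The condition \<open>nb xs w \<subseteq> W\<close>
  makes that rotation admissible.\<close>

lemma pivots_near_ends:
  assumes "distinct xs" "x \<in> ends G W xs t" "G w x" "w \<in> set xs" "nb xs w \<subseteq> W"
  shows "w \<in> ends G W xs t \<union> (\<Union>y\<in>ends G W xs (Suc t). nb xs y)"
proof (rule ccontr)
  assume neg: "\<not> ?thesis"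
  obtain ys where ys: "ys \<in> rotations G W xs t" "x = last ys" using assms(2) by (auto simp: ends_def)
  have m: "mset ys = mset xs" using suffix_rev_power_perm[OF rotations_suffix_rev[OF ys(1)]] .
  then have "w \<in> set ys" using assms(4) by (metis set_mset_mset)
  then obtain p q where pq: "ys = p @ w # q" by (meson split_list)
  define u where "u = p @ [w]"
  have u: "u \<noteq> []" "last u = w" "ys = u @ q" using pq by (auto simp: u_def)
  have "w \<noteq> x" using neg assms(2) by auto
  then have q: "q \<noteq> []" using u ys by auto
  have "nb xs w \<inter> ends G W xs t = {}" "w \<notin> ends G W xs t"
    using neg ends_mono[of G W xs t] by (auto simp: nb_sym[of w])
  then have "nb ys w = nb xs w" using rotations_untouched[OF assms(1) ys(1)] by blast
  then have hdq: "hd q \<in> nb xs w" using u q by (auto simp: nb_append)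
  have "u @ rev q \<in> rotations G W xs (Suc t)"
    using u q ys hdq assms by auto
  then have "hd q \<in> ends G W xs (Suc t)"
    unfolding ends_def using q by (intro image_eqI[of _ _ "u @ rev q"]) (auto simp: last_rev)
  then show False using neg hdq by (auto simp: nb_sym[of w])
qed

section \<open>Pseudorandom graphs and expansion under rotations\<close>

definition edge_count :: "(nat \<Rightarrow> nat \<Rightarrow> bool) \<Rightarrow> nat set \<Rightarrow> nat set \<Rightarrow> real" where
  "edge_count G X Y = (\<Sum>x\<in>X. real (card {y \<in> Y. G x y}))"

text \<open>Vertices whose use as a pivot keeps the new end in \<open>T\<close>. Leaving out the two
  end vertices of \<open>C\<close> ensures that neighbours within \<open>C\<close> are the
  neighbours in every repetition-free list containing \<open>C\<close> as a block.\<close>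

definition pivots :: "'a list \<Rightarrow> 'a set \<Rightarrow> 'a set" where
  "pivots C T = {w \<in> set C. w \<noteq> hd C \<and> w \<noteq> last C \<and> nb C w \<subseteq> T}"

text \<open>Apart from the two end vertices of \<open>C\<close>, a non-pivot is a path neighbour of
  some vertex outside \<open>T\<close>, and each such vertex has at most two neighbours.\<close>

lemma card_pivots:
  assumes "distinct C"
  shows "length C \<le> card (pivots C T) + 2 + 2 * card (set C - T)"
proof -
  let ?N = "\<Union>x\<in>set C - T. nb C x"
  have "set C \<subseteq> pivots C T \<union> {hd C, last C} \<union> ?N"
    using nb_subset[of C] nb_sym[of _ C] by (fastforce simp: pivots_def)
  then have "card (set C) \<le> card (pivots C T \<union> {hd C, last C} \<union> ?N)"
    by (intro card_mono) (auto simp: pivots_def intro: finite_subset[OF nb_subset])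
  also have "\<dots> \<le> card (pivots C T) + card {hd C, last C} + card ?N"
    by (meson add_le_mono card_Un_le le_refl le_trans)
  also have "\<dots> \<le> card (pivots C T) + 2 + 2 * card (set C - T)"
    using card_UN_nb_le[OF assms, of "set C - T"] by (intro add_mono) (auto simp: card_insert_if)
  finally show ?thesis using assms by (simp add: distinct_card)
qed

text \<open>The interface between spectrum and combinatorics. Mixing controls only averages, whereas
  rotations start from one given end, so a degree bound at every single vertex is included.\<close>

locale pseudorandom =
  fixes n :: nat and G :: "nat \<Rightarrow> nat \<Rightarrow> bool" and d \<mu> :: real
  assumes graph: "simple_graph_on n G"
    and n_pos: "n > 0"
    and d_pos: "d > 0"
    and mu_pos: "\<mu> > 0"
    and min_deg: "v < n \<Longrightarrow> d / 2 \<le> card {w \<in> {..<n}. G v w}"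
    and mixing: "X \<subseteq> {..<n} \<Longrightarrow> Y \<subseteq> {..<n} \<Longrightarrow>
       \<bar>edge_count G X Y - d * card X * card Y / n\<bar> \<le> \<mu> * sqrt (card X * card Y)"
begin

lemma symp_G: "symp G"
  using graph by (auto simp: simple_graph_on_def symp_def)

text \<open>The hypotheses on \<open>D\<close> say that \<open>B\<close> sends at most half the
  expected number of edges to \<open>Y\<close>. The missing half must then be covered by the error
  term of mixing.\<close>

lemma few_edges_small:
  fixes D :: real
  assumes "B \<subseteq> {..<n}" "Y \<subseteq> {..<n}" "edge_count G B Y \<le> D * card B" "D \<le> d * card Y / (2 * n)"
  shows "d\<^sup>2 * (card B * card Y) \<le> 4 * \<mu>\<^sup>2 * n\<^sup>2"
proof -
  define s where "s = sqrt (card B * card Y)"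
  have s: "s \<ge> 0" "s\<^sup>2 = card B * card Y" by (auto simp: s_def)
  have "D * card B \<le> d * card Y / (2 * n) * card B"
    by (rule mult_right_mono[OF assms(4)]) simp
  moreover have "d * card B * card Y / n - edge_count G B Y \<le> \<mu> * s"
    using mixing[OF assms(1,2)] by (simp add: s_def)
  ultimately have "d * card B * card Y / n \<le> d * card Y / (2 * n) * card B + \<mu> * s"
    using assms(3) by linarith
  then have "d * s\<^sup>2 / (2 * n) \<le> \<mu> * s"
    using n_pos by (simp add: s(2) field_simps)
  then have "d * s * s \<le> 2 * n * \<mu> * s" using n_pos by (simp add: field_simps power2_eq_square)
  then have "d * s \<le> 2 * n * \<mu>"
    using s(1) mu_pos by (cases "s = 0") auto
  then have "(d * s)\<^sup>2 \<le> (2 * n * \<mu>)\<^sup>2"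
    using s(1) d_pos by (intro power_mono) auto
  then show ?thesis by (simp add: power_mult_distrib s(2) algebra_simps)
qed

text \<open>The bound on \<open>card Q\<close> makes the main term of mixing at most half of the
  \<open>D * card S\<close> edges, so the error term must account for the other half.\<close>

lemma expansion:
  fixes D :: real
  assumes "S \<subseteq> {..<n}" "Q \<subseteq> {..<n}" "\<And>v. v \<in> S \<Longrightarrow> D \<le> card {w \<in> Q. G v w}" "0 \<le> D"
    "card Q \<le> D * n / (2 * d)"
  shows "D\<^sup>2 * card S \<le> 4 * \<mu>\<^sup>2 * card Q"
proof (cases "S = {}")
  case False
  then have cS: "card S > 0" using assms(1) finite_subset by (auto simp: card_gt_0_iff)
  have "D * card S = (\<Sum>v\<in>S. D)" by simp
  also have "\<dots> \<le> edge_count G S Q" unfolding edge_count_def by (rule sum_mono) (rule assms(3))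
  also have "\<dots> \<le> d * card S * card Q / n + \<mu> * sqrt (card S * card Q)"
    using mixing[OF assms(1,2)] by linarith
  also have "d * card S * card Q / n \<le> d * card S * (D * n / (2 * d)) / n"
    using assms(5) d_pos by (intro divide_right_mono mult_left_mono) auto
  also have "\<dots> = D * card S / 2" using d_pos n_pos by simp
  finally have "D * card S \<le> 2 * \<mu> * sqrt (card S * card Q)" by simp
  then have "(D * card S)\<^sup>2 \<le> (2 * \<mu> * sqrt (card S * card Q))\<^sup>2"
    using assms(4) by (intro power_mono) auto
  then have "(D\<^sup>2 * card S) * card S \<le> (4 * \<mu>\<^sup>2 * card Q) * card S"
    by (simp add: power_mult_distrib algebra_simps power2_eq_square)
  then show ?thesis using cS by simp
qed simp

text \<open>Without an edge the whole main term of mixing would have to be error, but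
  \<open>d * a > \<mu> * n\<close> makes it larger than that.\<close>

lemma edge_between:
  fixes a :: real
  assumes "X \<subseteq> {..<n}" "Y \<subseteq> {..<n}" "a \<le> card X" "a \<le> card Y" "a \<ge> 0" "d * a > \<mu> * n"
  shows "\<exists>x\<in>X. \<exists>y\<in>Y. G x y"
proof (rule ccontr)
  assume "\<not> ?thesis"
  then have "card {y \<in> Y. G x y} = 0" if "x \<in> X" for x
    using that by (metis (no_types, lifting) card.empty empty_Collect_eq)
  then have "edge_count G X Y = 0" unfolding edge_count_def by (intro sum.neutral) simp
  define s where "s = sqrt (card X * card Y)"
  have "a * a \<le> real (card X) * card Y" using assms by (intro mult_mono) auto
  then have as: "a \<le> s" unfolding s_def by (intro real_le_rsqrt) (simp add: power2_eq_square)
  have s: "s \<ge> 0" "s\<^sup>2 = card X * card Y" by (auto simp: s_def)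
  have "d * s\<^sup>2 / n \<le> \<mu> * s"
    using abs_le_D2[OF mixing[OF assms(1,2)]] \<open>edge_count G X Y = 0\<close> s
    by (simp add: s_def mult.assoc)
  then have "d * s * s \<le> \<mu> * n * s" using n_pos by (simp add: field_simps power2_eq_square)
  moreover have "d * s > \<mu> * n" using as assms(6) d_pos by (smt (verit) mult_left_mono)
  moreover have "s > 0"
  proof -
    have "0 < \<mu> * n" using mu_pos n_pos by simp
    then have "0 < d * a" using assms(6) by linarith
    then have "0 < a" using d_pos by (simp add: zero_less_mult_iff)
    then show ?thesis using as by linarith
  qed
  ultimately show False using mult_strict_right_mono by fastforce
qed

text \<open>Let \<open>Q\<close> be the admissible pivots adjacent to an end. By Posa's lemma
  \<open>card Q\<close> is at most three times the new number of ends. Either expansion applies, and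
  \<open>5 * \<mu> \<le> D\<close> gives \<open>Q\<close> at least 25/4 times the size of the old
  end set, hence doubling; or \<open>Q\<close> is already too large for it, and a third of its size
  is the cap.\<close>

lemma posa_step:
  fixes D :: real
  assumes "distinct xs" "xs \<noteq> []" "set xs \<subseteq> {..<n}" "W \<subseteq> {..<n}" "5 * \<mu> \<le> D"
    and D: "\<And>v. v \<in> insert (last xs) W \<Longrightarrow> D \<le> card {w \<in> set xs. nb xs w \<subseteq> W \<and> G v w}"
  shows "min (2 * card (ends G W xs t)) (D * n / (6 * d)) \<le> card (ends G W xs (Suc t))"
proof -
  define S where "S = ends G W xs t"
  define S' where "S' = ends G W xs (Suc t)"
  define Q where "Q = {w \<in> set xs. nb xs w \<subseteq> W \<and> (\<exists>x\<in>S. G w x)}"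
  have sub: "ends G W xs t \<subseteq> insert (last xs) W" for t
    using rotations_invariants[OF symp_G] assms(2) by (fastforce simp: ends_def)
  have insV: "insert (last xs) W \<subseteq> {..<n}" using assms last_in_set[of xs] by blast
  have S: "S \<subseteq> {..<n}" "S' \<subseteq> {..<n}" using sub insV by (auto simp: S_def S'_def)
  have Q: "Q \<subseteq> {..<n}" using assms by (auto simp: Q_def)
  have finS: "finite S" "finite S'" using S finite_subset by auto
  have DQ: "D \<le> card {w \<in> Q. G v w}" if "v \<in> S" for v
  proof -
    have "{w \<in> set xs. nb xs w \<subseteq> W \<and> G v w} = {w \<in> Q. G v w}"
      using that symp_G by (auto simp: Q_def symp_def)
    then show ?thesis using D[of v] that sub by (auto simp: S_def)
  qed
  have "Q \<subseteq> S \<union> (\<Union>y\<in>S'. nb xs y)"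
    using pivots_near_ends[OF assms(1)] by (force simp: Q_def S_def S'_def)
  then have "card Q \<le> card (S \<union> (\<Union>y\<in>S'. nb xs y))"
    using finS by (intro card_mono) (auto intro: finite_subset[OF nb_subset])
  also have "\<dots> \<le> card S + 2 * card S'"
    using card_Un_le[of S] card_UN_nb_le[OF assms(1) finS(2)] by (meson add_left_mono le_trans)
  also have "\<dots> \<le> 3 * card S'"
    using card_mono[OF finS(2), of S] ends_mono[of G W xs t] by (simp add: S_def S'_def)
  finally have Q3: "card Q \<le> 3 * card S'" .
  show ?thesis
  proof (cases "card Q \<le> D * n / (2 * d)")
    case True
    have "25 * \<mu>\<^sup>2 * card S \<le> D\<^sup>2 * card S"
      using power_mono[OF assms(5), of 2] mu_pos by (intro mult_right_mono) (auto simp: power_mult_distrib)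
    also have "\<dots> \<le> 4 * \<mu>\<^sup>2 * card Q"
      using expansion[OF S(1) Q DQ _ True] mu_pos assms(5) by simp
    finally have "\<mu>\<^sup>2 * (25 * card S) \<le> \<mu>\<^sup>2 * (4 * card Q)" by simp
    then have "25 * card S \<le> 4 * card Q" using mu_pos by simp
    with Q3 have "2 * card S \<le> card S'" by linarith
    then show ?thesis by (simp add: S_def S'_def)
  next
    case False
    have "D * n / (6 * d) = D * n / (2 * d) / 3" by simp
    also have "\<dots> \<le> card Q / 3" using False by simp
    also have "\<dots> \<le> card S'" using Q3 by linarith
    finally show ?thesis by (simp add: S'_def)
  qed
qed

text \<open>Starting from one end, \<open>\<rho>\<close> doublings reach \<open>2 ^ \<rho>\<close>,
  which is at least \<open>n\<close>; as \<open>D \<le> d\<close>, the cap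
  \<open>D * n / (6 * d)\<close> is the smaller of the two.\<close>

lemma posa:
  fixes D :: real
  assumes "distinct xs" "xs \<noteq> []" "set xs \<subseteq> {..<n}" "W \<subseteq> {..<n}" "5 * \<mu> \<le> D" "D \<le> d" "n \<le> 2 ^ \<rho>"
    and D: "\<And>v. v \<in> insert (last xs) W \<Longrightarrow> D \<le> card {w \<in> set xs. nb xs w \<subseteq> W \<and> G v w}"
  shows "D * n / (6 * d) \<le> card (ends G W xs \<rho>)"
proof -
  have "min (2 ^ t) (D * n / (6 * d)) \<le> card (ends G W xs t)" for t
  proof (induction t)
    case 0 show ?case by (simp add: ends_def)
  next
    case (Suc t)
    have "0 \<le> D * n / (6 * d)" using d_pos assms(5) mu_pos by (intro divide_nonneg_nonneg mult_nonneg_nonneg) auto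
    moreover have "min (2 * p) c \<le> r" if "min p c \<le> q" "min (2 * q) c \<le> r" "0 \<le> c" for p q r c :: real
      using that by (auto simp: min_def split: if_splits)
    ultimately show ?case using Suc.IH posa_step[OF assms(1-5) D, of t] unfolding power_Suc of_nat_mult
      by simp
  qed
  moreover have "D * n / (6 * d) \<le> 2 ^ \<rho>"
  proof -
    have "D * n / (6 * d) \<le> d * n / (6 * d)"
      using assms(6) d_pos by (intro divide_right_mono mult_right_mono) auto
    also have "\<dots> \<le> real n" using d_pos by simp
    also have "\<dots> \<le> real (2 ^ \<rho>)" using assms(7) by (simp only: of_nat_le_iff)
    finally show ?thesis by simp
  qed
  ultimately show ?thesis by (metis min_absorb2)
qed

text \<open>A largest set \<open>X\<close> of vertices of \<open>C\<close> with few edges to the pivots avoiding it is removed;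
  jumbledness keeps it small, so that nothing more has to be removed.\<close>
lemma core_exists:
  assumes "distinct C" "set C \<subseteq> {..<n}" "length C \<ge> 8" "24 * \<mu> * n \<le> d * length C"
  shows "\<exists>T \<subseteq> set C. length C \<le> 2 * card (pivots C T) \<and>
     (\<forall>v\<in>T. d * length C / (4 * n) \<le> card {w \<in> pivots C T. G v w})"
proof -
  define L where "L = length C"
  \<comment> \<open>Mixing predicts at least \<open>d * L / (2 * n)\<close> neighbours on average
    among \<open>L / 2\<close> or more pivots; half of that is the threshold.\<close>
  define D where "D = d * L / (4 * n)"
  \<comment> \<open>With at most \<open>L div 8\<close> vertices removed, at least
    \<open>L - 2 - L / 4\<close> pivots remain, which is at least \<open>L / 2\<close> because
    \<open>L\<close> is at least 8.\<close>
  define k where "k = L div 8"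
  define F where "F = {X. X \<subseteq> set C \<and> card X \<le> k \<and> edge_count G X (pivots C (set C - X)) \<le> D * card X}"
  have finF: "finite F" by (rule finite_subset[of _ "Pow (set C)"]) (auto simp: F_def)
  have "{} \<in> F" by (simp add: F_def edge_count_def)
  then obtain X where X: "X \<in> F" and max: "\<And>X'. X' \<in> F \<Longrightarrow> card X' \<le> card X"
    using Max_in[of "card ` F"] Max_ge[of "card ` F"] finF by (metis (no_types, lifting) emptyE finite_imageI imageE imageI)
  define T where "T = set C - X"
  define P where "P = pivots C T"
  have XC: "X \<subseteq> set C" "card X \<le> k" "edge_count G X P \<le> D * card X"
    using X by (auto simp: F_def P_def T_def)
  have CT: "set C - T = X" using XC by (auto simp: T_def)
  have "L \<le> card P + 2 + 2 * card X" using card_pivots[OF assms(1), of T] by (simp add: L_def P_def CT)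
  then have LP: "L \<le> 2 * card P" using XC(2) assms(3) by (simp add: k_def L_def)
  have PV: "P \<subseteq> {..<n}" using assms(2) by (auto simp: P_def pivots_def)
  have "D \<le> card {w \<in> P. G v w}" if v: "v \<in> T" for v
  proof (rule ccontr)
    assume neg: "\<not> ?thesis"
    define X' where "X' = insert v X"
    have fX: "finite X" "v \<notin> X" using XC v finite_subset by (auto simp: T_def)
    \<comment> \<open>Enlarging \<open>X\<close> shrinks the pivot set, and \<open>v\<close>
      contributes less than \<open>D\<close>. So \<open>X'\<close> again belongs to \<open>F\<close>
      unless it is too large, and maximality forces \<open>X\<close> to have the full size
      \<open>k\<close>.\<close>
    have "edge_count G X' (pivots C (set C - X')) \<le> edge_count G X' P"
      unfolding edge_count_def P_def T_def
      by (intro sum_mono) (auto intro!: card_mono simp: pivots_def X'_def)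
    also have "\<dots> = card {w \<in> P. G v w} + edge_count G X P" using fX by (simp add: edge_count_def X'_def)
    also have "\<dots> \<le> D * card X'" using neg XC fX by (simp add: X'_def algebra_simps)
    finally have "X' \<in> F" if "card X' \<le> k" using XC v that by (auto simp: F_def X'_def T_def)
    then have "card X' > k" using max[of X'] fX by (fastforce simp: X'_def)
    then have cX: "card X = k" using XC fX by (simp add: X'_def)
    have "D \<le> d * card P / (2 * n)"
      using LP d_pos n_pos by (simp add: D_def field_simps)
    then have 1: "d\<^sup>2 * (k * card P) \<le> 4 * \<mu>\<^sup>2 * n\<^sup>2"
      using few_edges_small[of X P D] XC PV assms(2) by (auto simp: cX)
    \<comment> \<open>Here 8 as lower bound for \<open>L\<close> is used again. Full size of
      \<open>X\<close> leads to 128 as a bound for the square of \<open>d * L / (\<mu> * n)\<close>,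
      against the square of 24.\<close>
    have k: "L \<le> 16 * k" using assms(3) unfolding k_def L_def[symmetric] by presburger
    have "L * L \<le> (16 * k) * (2 * card P)" by (rule mult_mono[OF k LP]) auto
    then have "real (L * L) \<le> real ((16 * k) * (2 * card P))" by (simp only: of_nat_le_iff)
    then have "real L * L \<le> 32 * (real k * card P)" by simp
    then have "d\<^sup>2 * (real L * L) \<le> d\<^sup>2 * (32 * (real k * card P))" by (rule mult_left_mono) simp
    also have "\<dots> \<le> 128 * \<mu>\<^sup>2 * n\<^sup>2" using 1 by (simp add: algebra_simps)
    finally have "(d * L)\<^sup>2 \<le> 128 * \<mu>\<^sup>2 * n\<^sup>2" by (simp add: power2_eq_square algebra_simps)
    moreover have "(24 * \<mu> * n)\<^sup>2 \<le> (d * L)\<^sup>2"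
      using assms(4) mu_pos by (intro power_mono) (auto simp: L_def)
    ultimately have "576 * (\<mu>\<^sup>2 * n\<^sup>2) \<le> 128 * (\<mu>\<^sup>2 * n\<^sup>2)" by (simp add: power_mult_distrib)
    then show False using mu_pos n_pos by simp
  qed
  then show ?thesis using LP by (intro exI[of _ T]) (auto simp: T_def P_def D_def L_def)
qed

text \<open>Rotations over all vertices, with \<open>D = d / 2\<close> from the minimum degree,
  reach at least \<open>n / 12\<close> ends, more than the set \<open>B\<close> to be avoided can
  contain.\<close>

lemma good_end:
  assumes "distinct xs" "set xs = {..<n}" "10 * \<mu> \<le> d" "n \<le> 2 ^ \<rho>" "12 * card B < n" "finite B"
  shows "\<exists>ys. (suffix_rev ^^ \<rho>) xs ys \<and> hd ys = hd xs \<and> last ys \<notin> B \<and> red G ys \<le> red G xs"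
proof -
  have "0 \<in> set xs" unfolding assms(2) using n_pos by simp
  then have ne: "xs \<noteq> []" by auto
  have "d / 2 * n / (6 * d) \<le> card (ends G {..<n} xs \<rho>)"
  proof (rule posa[OF assms(1) ne])
    fix v assume "v \<in> insert (last xs) {..<n}"
    then have "v < n" using last_in_set[OF ne] assms(2) by auto
    moreover have "{w \<in> set xs. nb xs w \<subseteq> {..<n} \<and> G v w} = {w \<in> {..<n}. G v w}"
      unfolding assms(2) using nb_subset[of xs, unfolded assms(2)] by simp
    ultimately show "d / 2 \<le> card {w \<in> set xs. nb xs w \<subseteq> {..<n} \<and> G v w}"
      using min_deg[of v] by simp
  qed (use assms d_pos in auto)
  then have "real n \<le> 12 * card (ends G {..<n} xs \<rho>)" using d_pos by simp
  then have cB: "card B < card (ends G {..<n} xs \<rho>)" using assms(5) by linarith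
  have "\<not> ends G {..<n} xs \<rho> \<subseteq> B" using card_mono[OF assms(6), of "ends G {..<n} xs \<rho>"] cB by linarith
  then obtain ys where "ys \<in> rotations G {..<n} xs \<rho>" "last ys \<notin> B"
    by (auto simp: ends_def)
  then show ?thesis using rotations_suffix_rev rotations_invariants[OF symp_G _ ne] by blast
qed

end

section \<open>Closing Hamilton paths\<close>

definition intact :: "'a list \<Rightarrow> 'a list \<Rightarrow> bool" where
  "intact C xs \<longleftrightarrow> (\<exists>p r. xs = p @ C @ r \<or> xs = p @ rev C @ r)"

lemma append_eq_middle_cases:
  assumes "u @ v = p @ C @ r"
  shows "(\<exists>r'. u = p @ C @ r') \<or> (\<exists>p'. v = p' @ C @ r) \<or>
         (u \<noteq> [] \<and> v \<noteq> [] \<and> last u \<in> set C \<and> hd v \<in> set C)"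
proof -
  from assms consider us where "u = p @ us" "us @ v = C @ r" | us where "v = us @ C @ r"
    by (auto simp: append_eq_append_conv2)
  then show ?thesis
  proof cases
    case 1
    from 1(2) consider us' where "us = C @ us'" | us' where "C = us @ us'" "v = us' @ r"
      by (auto simp: append_eq_append_conv2)
    then show ?thesis
    proof cases
      case (2 us')
      then show ?thesis using 1
        by (cases "us = []"; cases "us' = []") auto
    qed (use 1 in auto)
  qed auto
qed

lemma intact_append:
  assumes "intact C (u @ v)"
  shows "intact C u \<or> intact C v \<or> (u \<noteq> [] \<and> v \<noteq> [] \<and> last u \<in> set C \<and> hd v \<in> set C)"
proof -
  from assms obtain p r C' where "u @ v = p @ C' @ r" "C' = C \<or> C' = rev C"
    unfolding intact_def by blast
  then show ?thesis using append_eq_middle_cases[of u v p C' r] unfolding intact_def by auto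
qed

lemma intact_rev: "intact C xs \<Longrightarrow> intact C (rev xs)"
  unfolding intact_def by (metis append.assoc rev_append rev_rev_ident)

lemma intact_extend: "intact C xs \<Longrightarrow> intact C (p @ xs @ r)"
  unfolding intact_def by (metis append.assoc)

lemma intact_set: "intact C xs \<Longrightarrow> set C \<subseteq> set xs"
  unfolding intact_def by auto

lemma intact_suffix_rev:
  assumes "intact C (u @ v)" "\<not> intact C (u @ rev v)" shows "u \<noteq> [] \<and> last u \<in> set C"
  using intact_append[OF assms(1)] assms(2) intact_extend[of C u "[]" "rev v"]
    intact_extend[OF intact_rev[of C v], of u "[]"] by auto

lemma nb_intact:
  assumes "intact C xs" "distinct xs" "w \<in> set C" "w \<noteq> hd C" "w \<noteq> last C"
  shows "nb xs w = nb C w"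
proof -
  have "C \<noteq> []" using assms(3) by auto
  then show ?thesis
    using assms nb_middle[of _ C _ w] nb_middle[of _ "rev C" _ w]
    unfolding intact_def by (auto simp: hd_rev last_rev)
qed

text \<open>Each suffix reversal cuts the list at one place, hence breaks at most one of the disjoint segments.\<close>
lemma card_broken_le:
  assumes "finite \<C>" "\<And>C D. C \<in> \<C> \<Longrightarrow> D \<in> \<C> \<Longrightarrow> C \<noteq> D \<Longrightarrow> set C \<inter> set D = {}"
    "\<And>C. C \<in> \<C> \<Longrightarrow> intact C xs" "(suffix_rev ^^ t) xs ys"
  shows "card {C \<in> \<C>. \<not> intact C ys} \<le> t"
  using assms(4)
proof (induction t arbitrary: ys)
  case 0
  then have "{C \<in> \<C>. \<not> intact C ys} = {}" using assms(3) by auto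
  then show ?case by (simp only: card.empty)
next
  case (Suc t)
  then obtain zs where zs: "(suffix_rev ^^ t) xs zs" "suffix_rev zs ys" by auto
  then obtain u v where uv: "zs = u @ v" "ys = u @ rev v" unfolding suffix_rev_def by blast
  let ?N = "{C \<in> \<C>. intact C zs \<and> \<not> intact C ys}"
  have "card ?N \<le> Suc 0"
  proof (rule card_le_Suc0_iff_eq[THEN iffD2])
    show "\<forall>C\<in>?N. \<forall>D\<in>?N. C = D"
      using intact_suffix_rev[of _ u v] uv assms(2) by blast
  qed (use assms(1) in auto)
  moreover have "{C \<in> \<C>. \<not> intact C ys} \<subseteq> {C \<in> \<C>. \<not> intact C zs} \<union> ?N" by blast
  then have "card {C \<in> \<C>. \<not> intact C ys} \<le> card ({C \<in> \<C>. \<not> intact C zs} \<union> ?N)"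
    using assms(1) by (intro card_mono) auto
  then have "card {C \<in> \<C>. \<not> intact C ys} \<le> card {C \<in> \<C>. \<not> intact C zs} + card ?N"
    using card_Un_le le_trans by blast
  ultimately show ?case using Suc.IH[OF zs(1)] by linarith
qed

lemma segments_exist:
  assumes "distinct xs" "s * L \<le> length xs" "L \<ge> 1"
  shows "\<exists>\<C>. finite \<C> \<and> card \<C> = s \<and> (\<forall>C\<in>\<C>. length C = L \<and> distinct C \<and> intact C xs) \<and>
     (\<forall>C\<in>\<C>. \<forall>D\<in>\<C>. C \<noteq> D \<longrightarrow> set C \<inter> set D = {})"
  using assms
proof (induction s arbitrary: xs)
  case 0 then show ?case by (intro exI[of _ "{}"]) auto
next
  case (Suc s)
  have "distinct (drop L xs)" "s * L \<le> length (drop L xs)" using Suc.prems by auto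
  from Suc.IH[OF this Suc.prems(3)] obtain \<C> where c: "finite \<C>" "card \<C> = s"
    and 1: "\<forall>C\<in>\<C>. length C = L \<and> distinct C \<and> intact C (drop L xs)"
    and 2: "\<forall>C\<in>\<C>. \<forall>D\<in>\<C>. C \<noteq> D \<longrightarrow> set C \<inter> set D = {}"
    by (elim exE conjE) (rule that, assumption+)
  let ?C = "take L xs"
  have dis: "set ?C \<inter> set C = {}" if "C \<in> \<C>" for C
    using bspec[OF 1 that] intact_set[of C "drop L xs"] set_take_disj_set_drop_if_distinct[OF Suc.prems(1), of L L]
    by blast
  have len: "length ?C = L" using Suc.prems by auto
  then have ne: "?C \<noteq> []" using Suc.prems(3) by auto
  have "?C \<notin> \<C>" using dis ne by fastforce
  moreover have "intact C xs" if "C \<in> \<C>" for C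
    using intact_extend[of C "drop L xs" "take L xs" "[]"] bspec[OF 1 that] by simp
  moreover have "intact ?C xs" unfolding intact_def
    by (intro exI[of _ "[]"] exI[of _ "drop L xs"]) simp
  ultimately show ?case using c 1 2 dis len Suc.prems(1)
    by (intro exI[of _ "insert ?C \<C>"]) (auto simp: Int_commute)
qed

text \<open>Two disjoint blocks lie one after the other, so a cut directly before or after
  \<open>C\<close> separates them. The two halves can then be rotated independently.\<close>

lemma intact_split:
  assumes "intact C zs" "intact D zs" "C \<noteq> []" "D \<noteq> []" "set C \<inter> set D = {}"
  shows "\<exists>z1 z2. zs = z1 @ z2 \<and> (intact C z1 \<and> intact D z2 \<or> intact D z1 \<and> intact C z2)"
proof -
  from assms(1) obtain p r C' where zs: "zs = p @ C' @ r" and C': "C' = C \<or> C' = rev C"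
    unfolding intact_def by blast
  have C'p: "C' \<noteq> []" "set C' = set C" using C' assms(3) by auto
  have CC: "intact C C'" using C' unfolding intact_def by (metis append_Nil append_Nil2)
  have h: "hd C' \<notin> set D" "last C' \<notin> set D"
    using C'p hd_in_set[of C'] last_in_set[of C'] assms(5) by auto
  have "\<not> intact D C'" using intact_set[of D C'] C'p assms(4,5)
    by (metis Int_absorb1 set_empty)
  then consider "intact D p" | "intact D r"
    using intact_append[of D p "C' @ r"] intact_append[of D C' r] assms(2) zs h C'p by auto
  then show ?thesis
  proof cases
    case 1
    moreover have "intact C (C' @ r)" using intact_extend[OF CC, of "[]" r] by simp
    ultimately show ?thesis using zs by blast
  next
    case 2
    moreover have "intact C (p @ C')" using intact_extend[OF CC, of p "[]"] by simp
    ultimately show ?thesis using zs by (metis append.assoc)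
  qed
qed

context pseudorandom
begin

text \<open>Pivots of \<open>C\<close> keep their neighbours in every list containing
  \<open>C\<close> intact, so a condition on \<open>C\<close> and \<open>T\<close> alone supplies
  Posa's argument for all of \<open>z\<close>.\<close>

lemma posa_segment:
  assumes "intact C z" "distinct z" "set z \<subseteq> {..<n}" "z \<noteq> []" "T \<subseteq> {..<n}"
    "5 * \<mu> \<le> D" "D \<le> d" "n \<le> 2 ^ \<rho>"
    and D: "\<And>v. v \<in> insert (last z) T \<Longrightarrow> D \<le> card {w \<in> pivots C T. G v w}"
  shows "D * n / (6 * d) \<le> card (ends G T z \<rho>)"
proof (rule posa[OF assms(2,4,3,5,6,7,8)])
  fix v assume v: "v \<in> insert (last z) T"
  have "{w \<in> pivots C T. G v w} \<subseteq> {w \<in> set z. nb z w \<subseteq> T \<and> G v w}"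
    using nb_intact[OF assms(1,2)] intact_set[OF assms(1)] by (auto simp: pivots_def)
  then have "card {w \<in> pivots C T. G v w} \<le> card {w \<in> set z. nb z w \<subseteq> T \<and> G v w}"
    by (intro card_mono) auto
  then show "D \<le> card {w \<in> set z. nb z w \<subseteq> T \<and> G v w}" using D[OF v] by linarith
qed

text \<open>The final list is cut into two halves that are rotated at their outer ends only, so
  their common junction never moves; the closing edge joins the two outer ends.\<close>

lemma close_path:
  assumes xs: "distinct xs" "set xs = {..<n}"
    and s: "s = 2 * \<rho> + 3" and rho: "n \<le> 2 ^ \<rho>" and ns: "16 * s \<le> n" and ds: "100 * \<mu> * s \<le> d"
  shows "\<exists>ys. (suffix_rev ^^ (4 * \<rho> + 3)) xs ys \<and> red G ys \<le> red G xs \<and> G (last ys) (hd ys)"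
proof -
  define L where "L = n div s"
  define D where "D = d * L / (4 * n)"
  have s0: "s > 0" using s by simp
  have L16: "16 \<le> L" using ns s0 by (simp add: L_def less_eq_div_iff_mult_less_eq)
  have "n < s * (L + 1)" using s0 by (simp add: L_def) (metis dividend_less_times_div)
  also have "\<dots> \<le> s * (2 * L)" using L16 by simp
  finally have nL: "n \<le> 2 * s * L" by simp
  then have nLr: "real n \<le> 2 * s * L" by (metis of_nat_le_iff of_nat_mult of_nat_numeral)
  have sL: "s * L \<le> n" by (simp add: L_def)
  have Ln: "L \<le> n" by (simp add: L_def)
  have "length xs = n" using xs by (metis card_lessThan distinct_card)
  have dL: "50 * \<mu> * n \<le> d * L"
  proof -
    have "50 * \<mu> * n \<le> 50 * \<mu> * (2 * s * L)" by (rule mult_left_mono[OF nLr]) (use mu_pos in simp)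
    also have "\<dots> = (100 * \<mu> * s) * L" by simp
    also have "\<dots> \<le> d * L" by (rule mult_right_mono[OF ds]) simp
    finally show ?thesis .
  qed
  have "0 \<le> \<mu> * n" using mu_pos by simp
  then have "20 * \<mu> * n \<le> d * L" using dL by linarith
  then have D5: "5 * \<mu> \<le> D" using n_pos by (simp add: D_def field_simps)
  have Dd: "D \<le> d"
  proof -
    have "d * L \<le> d * (4 * n)" using Ln d_pos by (intro mult_left_mono) auto
    then show ?thesis using n_pos by (simp add: D_def field_simps)
  qed
  obtain \<C> where \<C>: "finite \<C>" "card \<C> = s"
    and C: "\<And>C. C \<in> \<C> \<Longrightarrow> length C = L \<and> distinct C \<and> intact C xs"
    and disj: "\<And>C D. C \<in> \<C> \<Longrightarrow> D \<in> \<C> \<Longrightarrow> C \<noteq> D \<Longrightarrow> set C \<inter> set D = {}"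
    using segments_exist[OF xs(1), of s L] sL L16 \<open>length xs = n\<close> by auto
  have CV: "set C \<subseteq> {..<n}" if "C \<in> \<C>" for C using C[OF that] intact_set xs by blast
  have "\<forall>C\<in>\<C>. \<exists>T. T \<subseteq> set C \<and> L \<le> 2 * card (pivots C T) \<and>
     (\<forall>v\<in>T. D \<le> card {w \<in> pivots C T. G v w})"
  proof
    fix C assume c: "C \<in> \<C>"
    have "24 * \<mu> * n \<le> d * length C" using dL \<open>0 \<le> \<mu> * n\<close> C[OF c] by simp
    then obtain T where "T \<subseteq> set C" "length C \<le> 2 * card (pivots C T)"
      "\<forall>v\<in>T. d * length C / (4 * n) \<le> card {w \<in> pivots C T. G v w}"
      using core_exists[of C] C[OF c] CV[OF c] L16 by auto
    then show "\<exists>T. T \<subseteq> set C \<and> L \<le> 2 * card (pivots C T) \<and> (\<forall>v\<in>T. D \<le> card {w \<in> pivots C T. G v w})"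
      using C[OF c] unfolding D_def by (intro exI[of _ T]) simp
  qed
  from bchoice[OF this] obtain T where T': "\<forall>C\<in>\<C>. T C \<subseteq> set C \<and> L \<le> 2 * card (pivots C (T C)) \<and>
     (\<forall>v\<in>T C. D \<le> card {w \<in> pivots C (T C). G v w})" by (elim exE) (rule that)
  have T: "T C \<subseteq> set C" and LT: "L \<le> 2 * card (pivots C (T C))"
    and DT: "\<And>v. v \<in> T C \<Longrightarrow> D \<le> card {w \<in> pivots C (T C). G v w}" if "C \<in> \<C>" for C
    using bspec[OF T' that] by auto
  \<comment> \<open>Vertices from which confined rotations in the core of \<open>C\<close> could not
    start. Both ends are first moved away from all of them.\<close>
  define bad where "bad C = {v \<in> {..<n}. card {w \<in> pivots C (T C). G v w} < D}" for C
  define B where "B = (\<Union>C\<in>\<C>. bad C)"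
  \<comment> \<open>Too few edges run from \<open>bad C\<close> to the at least \<open>L / 2\<close>
    pivots, which bounds its size. The factor 24 keeps the union over the \<open>s\<close> segments
    below \<open>n / 12\<close>, as \<open>good_end\<close> requires.\<close>
  have card_bad: "24 * s * card (bad C) \<le> n" if c: "C \<in> \<C>" for C
  proof -
    let ?P = "pivots C (T C)"
    have "edge_count G (bad C) ?P \<le> (\<Sum>v\<in>bad C. D)"
      unfolding edge_count_def by (rule sum_mono) (simp add: bad_def)
    then have "edge_count G (bad C) ?P \<le> D * card (bad C)" by (simp add: mult.commute)
    moreover have "D \<le> d * card ?P / (2 * n)"
      using LT[OF c] d_pos n_pos by (simp add: D_def field_simps)
    moreover have "?P \<subseteq> {..<n}" using CV[OF c] by (auto simp: pivots_def)
    ultimately have 1: "d\<^sup>2 * (card (bad C) * card ?P) \<le> 4 * \<mu>\<^sup>2 * n\<^sup>2"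
      by (intro few_edges_small) (auto simp: bad_def)
    have "real (card (bad C)) * L \<le> real (card (bad C)) * (2 * card ?P)"
      using LT[OF c] by (intro mult_left_mono) auto
    then have "d\<^sup>2 * (real (card (bad C)) * L) \<le> d\<^sup>2 * (real (card (bad C)) * (2 * card ?P))"
      by (rule mult_left_mono) simp
    also have "\<dots> \<le> 8 * \<mu>\<^sup>2 * n\<^sup>2" using 1 by (simp add: algebra_simps)
    finally have 2: "d\<^sup>2 * card (bad C) * L \<le> 8 * \<mu>\<^sup>2 * n\<^sup>2" by (simp add: mult.assoc)
    have "(50 * \<mu> * n) * (100 * \<mu> * s) \<le> (d * L) * d"
      using mult_mono[OF dL ds] mu_pos d_pos by simp
    then have "(50 * \<mu> * n) * (100 * \<mu> * s) * card (bad C) \<le> (d * L) * d * card (bad C)"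
      by (rule mult_right_mono) simp
    also have "\<dots> = d\<^sup>2 * card (bad C) * L" by (simp add: power2_eq_square)
    also note 2
    finally have "(8 * \<mu>\<^sup>2 * n) * (625 * s * card (bad C)) \<le> (8 * \<mu>\<^sup>2 * n) * n"
      by (simp add: power2_eq_square algebra_simps)
    then have "625 * (real s * card (bad C)) \<le> n" using mu_pos n_pos by simp
    then have "real (625 * (s * card (bad C))) \<le> real n" by simp
    then show ?thesis unfolding of_nat_le_iff by linarith
  qed
  have "card B \<le> (\<Sum>C\<in>\<C>. card (bad C))" unfolding B_def by (rule card_UN_le[OF \<C>(1)])
  then have "24 * s * card B \<le> (\<Sum>C\<in>\<C>. 24 * s * card (bad C))"
    by (simp add: sum_distrib_left[symmetric])
  also have "\<dots> \<le> (\<Sum>C\<in>\<C>. n)" by (rule sum_mono) (rule card_bad)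
  also have "\<dots> = s * n" by (simp add: \<C>)
  finally have "s * (24 * card B) \<le> s * n" by (simp add: ac_simps)
  then have cB: "12 * card B < n" using s0 n_pos by simp
  have fB: "finite B" using \<C> by (auto simp: B_def bad_def)
  have good: "D \<le> card {w \<in> pivots C (T C). G v w}" if "v \<notin> B" "v < n" "C \<in> \<C>" for v C
    using that by (auto simp: B_def bad_def)
  have "100 * \<mu> * 1 \<le> 100 * \<mu> * s" using s0 mu_pos by (intro mult_left_mono) auto
  then have d10: "10 * \<mu> \<le> d" using ds mu_pos by linarith

  obtain ys where ys: "(suffix_rev ^^ \<rho>) xs ys" "last ys \<notin> B" "red G ys \<le> red G xs"
    using good_end[OF xs d10 rho cB fB] by blast
  have mys: "mset ys = mset xs" using suffix_rev_power_perm[OF ys(1)] .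
  have ysd: "distinct (rev ys)" "set (rev ys) = {..<n}"
    using mys xs by (metis distinct_rev mset_eq_imp_distinct_iff) (metis mys xs(2) set_mset_mset set_rev)
  \<comment> \<open>The reversal brings the other end into position; \<open>hd zs\<close> is the
    good end found before, which these rotations leave fixed.\<close>
  obtain zs where zs: "(suffix_rev ^^ \<rho>) (rev ys) zs" "hd zs = hd (rev ys)" "last zs \<notin> B" "red G zs \<le> red G (rev ys)"
    using good_end[OF ysd d10 rho cB fB] by blast
  have "(suffix_rev ^^ (\<rho> + 1)) xs (rev ys)"
    using ys(1) suffix_rev_rev[of ys] by auto
  from suffix_rev_power_trans[OF this zs(1)] have xz: "(suffix_rev ^^ (2 * \<rho> + 1)) xs zs" by (simp add: mult_2)
  have mzs: "mset zs = mset xs" using suffix_rev_power_perm[OF xz] .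
  have zsd: "distinct zs" "set zs = {..<n}"
    using mzs xs mset_eq_imp_distinct_iff by blast (metis mzs xs(2) set_mset_mset)
  have "0 \<in> set (rev ys)" unfolding ysd(2) using n_pos by simp
  then have "ys \<noteq> []" by auto
  then have hdz: "hd zs \<notin> B" using zs(2) ys(2) by (simp add: hd_rev)
  have redz: "red G zs \<le> red G xs" using zs(4) ys(3) by (simp add: red_rev[OF symp_G])

  \<comment> \<open>Reaching \<open>zs\<close> took \<open>2 * \<rho> + 1\<close> reversals, each
    breaking at most one segment; with \<open>s = 2 * \<rho> + 3\<close> at least two
    survive.\<close>
  have "card {C \<in> \<C>. \<not> intact C zs} \<le> 2 * \<rho> + 1"
    using card_broken_le[OF \<C>(1) disj _ xz] C by blast
  moreover have "\<C> = {C \<in> \<C>. intact C zs} \<union> {C \<in> \<C>. \<not> intact C zs}" by blast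
  then have "s \<le> card {C \<in> \<C>. intact C zs} + card {C \<in> \<C>. \<not> intact C zs}"
    using \<C> card_Un_le by metis
  ultimately have "2 \<le> card {C \<in> \<C>. intact C zs}" using s by linarith
  then obtain C1 C2 where C12: "C1 \<in> \<C>" "C2 \<in> \<C>" "C1 \<noteq> C2" "intact C1 zs" "intact C2 zs"
    by (auto simp: numeral_2_eq_2 card_le_Suc_iff)
  have "C1 \<noteq> []" "C2 \<noteq> []" using C C12 L16 by fastforce+
  from intact_split[OF C12(4,5) this disj[OF C12(1-3)]]
  obtain z1 z2 E1 E2 where z: "zs = z1 @ z2" "intact E1 z1" "intact E2 z2" "E1 \<in> \<C>" "E2 \<in> \<C>"
    using C12 by blast
  have ne: "z1 \<noteq> []" "z2 \<noteq> []" using z C[of E1] C[of E2] L16 unfolding intact_def by auto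
  \<comment> \<open>The outer ends of the halves are the two good ends; rotating
    \<open>rev z1\<close> and \<open>z2\<close> there fixes the vertices at the cut.\<close>
  have lastz: "last (rev z1) = hd zs" "last z2 = last zs" using ne z by (auto simp: last_rev)
  have "hd zs \<in> set zs" "last zs \<in> set zs" using ne z(1) by auto
  then have inV: "hd zs < n" "last zs < n" unfolding zsd(2) by auto
  have TV: "T C \<subseteq> {..<n}" if "C \<in> \<C>" for C using T CV that by blast
  have zd: "distinct (rev z1)" "distinct z2" "set (rev z1) \<subseteq> {..<n}" "set z2 \<subseteq> {..<n}"
    using zsd(1) unfolding zsd(2)[symmetric] z(1) by auto
  have "D \<le> card {w \<in> pivots E1 (T E1). G v w}" if "v \<in> insert (last (rev z1)) (T E1)" for v
    using that good[OF hdz inV(1) z(4)] DT[OF z(4), of v] unfolding lastz by blast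
  then have e1: "D * n / (6 * d) \<le> card (ends G (T E1) (rev z1) \<rho>)"
    using posa_segment[OF intact_rev[OF z(2)] zd(1,3) _ TV[OF z(4)] D5 Dd rho] ne by simp
  have "D \<le> card {w \<in> pivots E2 (T E2). G v w}" if "v \<in> insert (last z2) (T E2)" for v
    using that good[OF zs(3) inV(2) z(5)] DT[OF z(5), of v] unfolding lastz by blast
  then have e2: "D * n / (6 * d) \<le> card (ends G (T E2) z2 \<rho>)"
    using posa_segment[OF z(3) zd(2,4) ne(2) TV[OF z(5)] D5 Dd rho] by simp
  \<comment> \<open>Each end set thus has at least \<open>L / 24\<close> elements, and
    \<open>50 * \<mu> * n \<le> d * L\<close> is more than \<open>edge_between\<close>
    needs.\<close>
  have a: "D * n / (6 * d) = L / 24" using d_pos n_pos by (simp add: D_def)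
  have "ends G (T E1) (rev z1) \<rho> \<subseteq> {..<n}" "ends G (T E2) z2 \<rho> \<subseteq> {..<n}"
    using rotations_invariants[OF symp_G _ ne(2), of _ "T E2" \<rho>]
      rotations_invariants[OF symp_G, of _ "T E1" "rev z1" \<rho>] ne(1) lastz inV TV[OF z(4)] TV[OF z(5)]
    by (fastforce simp: ends_def)+
  moreover have "0 < \<mu> * n" using mu_pos n_pos by simp
  then have "\<mu> * n < d * (L / 24)" using dL by linarith
  ultimately obtain x y where xy: "x \<in> ends G (T E1) (rev z1) \<rho>" "y \<in> ends G (T E2) z2 \<rho>" "G x y"
    using edge_between[of _ _ "L / 24"] e1 e2 unfolding a by (metis of_nat_0_le_iff zero_le_divide_iff zero_le_numeral)
  obtain y1 where y1: "y1 \<in> rotations G (T E1) (rev z1) \<rho>" "last y1 = x" using xy by (auto simp: ends_def)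
  obtain y2 where y2: "y2 \<in> rotations G (T E2) z2 \<rho>" "last y2 = y" using xy by (auto simp: ends_def)
  have i1: "y1 \<noteq> []" "hd y1 = last z1" "red G y1 \<le> red G z1"
    using rotations_invariants[OF symp_G y1(1)] ne by (auto simp: hd_rev red_rev[OF symp_G])
  have i2: "y2 \<noteq> []" "hd y2 = hd z2" "red G y2 \<le> red G z2"
    using rotations_invariants[OF symp_G y2(1)] ne by auto
  \<comment> \<open>The list passes from \<open>z1 @ z2\<close> through \<open>z1 @ y2\<close>,
    \<open>rev y2 @ rev z1\<close> and \<open>rev y2 @ y1\<close> to
    \<open>rev y1 @ y2\<close>.\<close>
  have "(suffix_rev ^^ \<rho>) zs (z1 @ y2)"
    unfolding z(1) by (rule suffix_rev_power_append[OF rotations_suffix_rev[OF y2(1)]])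
  moreover have "(suffix_rev ^^ 1) (z1 @ y2) (rev y2 @ rev z1)"
    using suffix_rev_rev[of "z1 @ y2"] by auto
  moreover have "(suffix_rev ^^ \<rho>) (rev y2 @ rev z1) (rev y2 @ y1)"
    by (rule suffix_rev_power_append[OF rotations_suffix_rev[OF y1(1)]])
  moreover have "(suffix_rev ^^ 1) (rev y2 @ y1) (rev y1 @ y2)"
    using suffix_rev_rev[of "rev y2 @ y1"] by auto
  ultimately have "(suffix_rev ^^ (2 * \<rho> + 1 + \<rho> + 1 + \<rho> + 1)) xs (rev y1 @ y2)"
    using xz by (meson suffix_rev_power_trans)
  \<comment> \<open>The junction is still \<open>last z1\<close> followed by \<open>hd z2\<close>,
    so only red pairs inside the halves need comparing.\<close>
  moreover have "red G (rev y1 @ y2) \<le> red G zs"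
    using i1 i2 ne by (simp add: red_append red_rev[OF symp_G] last_rev z(1))
  moreover have "G (last (rev y1 @ y2)) (hd (rev y1 @ y2))"
    using i1 i2 y1 y2 xy(3) sympD[OF symp_G] by (auto simp: hd_rev)
  moreover have "2 * \<rho> + 1 + \<rho> + 1 + \<rho> + 1 = 4 * \<rho> + 3" by simp
  ultimately show ?thesis using redz by (metis le_trans)
qed

text \<open>A round closes the list with \<open>4 * \<rho> + 3\<close> reversals and reopens it at a
  red pair with three more, removing that pair. After at most \<open>r\<close> such rounds, a last
  one closes a list without red pairs.\<close>

lemma ham_cycle_near_path:
  assumes s: "s = 2 * \<rho> + 3" and rho: "n \<le> 2 ^ \<rho>" and ns: "16 * s \<le> n" and ds: "100 * \<mu> * s \<le> d"
    and xs: "distinct xs" "set xs = {..<n}" "red G xs \<le> r"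
  shows "\<exists>ys. (suffix_rev ^^ ((r + 1) * (4 * \<rho> + 6))) xs ys \<and> successively G ys \<and> G (last ys) (hd ys)"
  using xs
proof (induction r arbitrary: xs)
  case 0
  from close_path[OF 0(1,2) s rho ns ds] 0(3) obtain ys where
    "(suffix_rev ^^ (4 * \<rho> + 3)) xs ys" "successively G ys" "G (last ys) (hd ys)"
    by (auto simp: red_eq_0_iff[symmetric])
  then show ?case using suffix_rev_power_mono[of "4 * \<rho> + 3" xs ys "4 * \<rho> + 6"] by auto
next
  case (Suc r)
  from close_path[OF Suc.prems(1,2) s rho ns ds] obtain ys where
    ys: "(suffix_rev ^^ (4 * \<rho> + 3)) xs ys" "red G ys \<le> red G xs" "G (last ys) (hd ys)" by blast
  have "\<exists>zs. (suffix_rev ^^ (4 * \<rho> + 6)) xs zs \<and> red G zs \<le> r"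
  proof (cases "red G ys = 0")
    case True
    then show ?thesis using suffix_rev_power_mono[OF ys(1), of "4 * \<rho> + 6"] by auto
  next
    case False
    then obtain u v where uv: "ys = u @ v" "u \<noteq> []" "v \<noteq> []" "\<not> G (last u) (hd v)"
      using red_pos_split[of G ys] by auto
    \<comment> \<open>The new junction joins \<open>last ys\<close> to \<open>hd ys\<close>, which
      is an edge, while the red pair at the cut disappears.\<close>
    have "red G (v @ u) \<le> r" using ys uv Suc.prems(3) by (simp add: red_append)
    moreover have "(suffix_rev ^^ (4 * \<rho> + 3 + 3)) xs (v @ u)"
      using suffix_rev_power_trans[OF ys(1)] suffix_rev_power_rotate uv(1) by blast
    ultimately show ?thesis by (intro exI[of _ "v @ u"]) (simp add: add.commute)
  qed
  then obtain zs where zs: "(suffix_rev ^^ (4 * \<rho> + 6)) xs zs" "red G zs \<le> r" by blast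
  have m: "mset zs = mset xs" using suffix_rev_power_perm[OF zs(1)] .
  have "distinct zs" "set zs = {..<n}"
    using m Suc.prems mset_eq_imp_distinct_iff by blast (metis m Suc.prems(2) set_mset_mset)
  from Suc.IH[OF this zs(2)] obtain ws where
    "(suffix_rev ^^ ((r + 1) * (4 * \<rho> + 6))) zs ws" "successively G ws" "G (last ws) (hd ws)" by blast
  then show ?case using suffix_rev_power_trans[OF zs(1)] by fastforce
qed

end

section \<open>Matchings, path systems and counting\<close>

text \<open>For \<open>R\<close> and \<open>S\<close> of equal finite size, the number of these is
  the permanent of the adjacency submatrix with rows \<open>R\<close> and columns \<open>S\<close>.
  Extensionality makes each bijection count once.\<close>

definition matchings :: "(nat \<Rightarrow> nat \<Rightarrow> bool) \<Rightarrow> nat set \<Rightarrow> nat set \<Rightarrow> (nat \<Rightarrow> nat) set" where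
  "matchings G R S = {f \<in> R \<rightarrow>\<^sub>E S. bij_betw f R S \<and> (\<forall>x\<in>R. G x (f x))}"

lemma finite_matchings: "finite R \<Longrightarrow> finite S \<Longrightarrow> finite (matchings G R S)"
  unfolding matchings_def by (rule finite_subset[OF _ finite_PiE[of R "\<lambda>_. S"]]) auto

text \<open>Expansion of the permanent along row \<open>i\<close>.\<close>

lemma card_matchings_step:
  assumes "finite R" "finite S" "i \<in> R"
  shows "card (matchings G R S) \<le> (\<Sum>y\<in>{y \<in> S. G i y}. card (matchings G (R - {i}) (S - {y})))"
proof -
  have "matchings G R S \<subseteq> (\<Union>y\<in>{y \<in> S. G i y}. (\<lambda>f. f(i := y)) ` matchings G (R - {i}) (S - {y}))"
  proof
    fix f assume f: "f \<in> matchings G R S"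
    then have fi: "f i \<in> S" "G i (f i)" using assms(3) by (auto simp: matchings_def)
    \<comment> \<open>The value at \<open>i\<close> is reset to \<open>undefined\<close> so that
      \<open>g\<close> is extensional on \<open>R - {i}\<close>.\<close>
    define g where "g = f(i := undefined)"
    have "bij_betw f (R - {i}) (S - {f i})"
      using f assms(3) by (auto simp: matchings_def intro: bij_betw_DiffI)
    then have b: "bij_betw g (R - {i}) (S - {f i})"
      unfolding g_def by (subst bij_betw_cong[of _ _ f]) auto
    have "g \<in> matchings G (R - {i}) (S - {f i})"
      using f b bij_betwE[OF b] unfolding matchings_def
      by (auto simp: PiE_iff extensional_def g_def)
    moreover have "f = g(i := f i)" by (auto simp: g_def)
    ultimately show "f \<in> (\<Union>y\<in>{y \<in> S. G i y}. (\<lambda>f. f(i := y)) ` matchings G (R - {i}) (S - {y}))"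
      using fi by blast
  qed
  then have "card (matchings G R S) \<le>
      card (\<Union>y\<in>{y \<in> S. G i y}. (\<lambda>f. f(i := y)) ` matchings G (R - {i}) (S - {y}))"
    using assms by (intro card_mono) (auto intro!: finite_matchings)
  also have "\<dots> \<le> (\<Sum>y\<in>{y \<in> S. G i y}. card ((\<lambda>f. f(i := y)) ` matchings G (R - {i}) (S - {y})))"
    using assms by (intro card_UN_le) auto
  also have "\<dots> \<le> (\<Sum>y\<in>{y \<in> S. G i y}. card (matchings G (R - {i}) (S - {y})))"
    using assms by (intro sum_mono card_image_le finite_matchings) auto
  finally show ?thesis .
qed

text \<open>Traversing a Hamilton cycle gives its successor permutation, from which the edge set is
  recovered; so there are at most as many cycles as matchings.\<close>

lemma hamilton_cycles_matching:
  "hamilton_cycles n G \<subseteq> (\<lambda>\<sigma>. (\<lambda>x. {x, \<sigma> x}) ` {..<n}) ` matchings G {..<n} {..<n}"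
proof
  fix C assume "C \<in> hamilton_cycles n G"
  then obtain v where v: "bij_betw v {..<n} {..<n}" "\<And>i. i < n \<Longrightarrow> G (v i) (v ((i + 1) mod n))"
    and C: "C = (\<lambda>i. {v i, v ((i + 1) mod n)}) ` {..<n}" by (auto simp: hamilton_cycles_def)
  define w where "w = the_inv_into {..<n} v"
  have w: "bij_betw w {..<n} {..<n}" unfolding w_def by (rule bij_betw_the_inv_into[OF v(1)])
  have wv: "w (v i) = i" if "i < n" for i
    unfolding w_def using that v(1) by (intro the_inv_into_f_f) (auto simp: bij_betw_def)
  have vw: "v (w x) = x" if "x < n" for x
    unfolding w_def using that v(1) by (intro f_the_inv_into_f) (auto simp: bij_betw_def)
  have wn: "w x < n" if "x < n" for x using bij_betwE[OF w] that by auto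
  define \<sigma> where "\<sigma> = (\<lambda>x\<in>{..<n}. v ((w x + 1) mod n))"
  have "inj_on (\<lambda>i. (i + 1) mod n) {..<n}"
    by (rule inj_onI) (auto simp: mod_Suc split: if_splits)
  moreover have "(\<lambda>i. (i + 1) mod n) ` {..<n} \<subseteq> {..<n}" by auto
  ultimately have "bij_betw (\<lambda>i. (i + 1) mod n) {..<n} {..<n}"
    by (simp add: bij_betw_def endo_inj_surj)
  from bij_betw_trans[OF bij_betw_trans[OF w this] v(1)]
  have \<sigma>: "bij_betw \<sigma> {..<n} {..<n}" by (subst bij_betw_cong[of _ \<sigma>]) (auto simp: \<sigma>_def)
  have "G x (\<sigma> x)" if "x < n" for x using v(2)[OF wn[OF that]] vw[OF that] that by (simp add: \<sigma>_def)
  moreover have "\<sigma> \<in> {..<n} \<rightarrow>\<^sub>E {..<n}" using bij_betwE[OF \<sigma>] by (simp add: PiE_iff) (simp add: \<sigma>_def)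
  ultimately have "\<sigma> \<in> matchings G {..<n} {..<n}"
    using \<sigma> by (simp add: matchings_def)
  moreover have "C = (\<lambda>x. {x, \<sigma> x}) ` {..<n}"
  proof -
    have "C = (\<lambda>i. {v i, \<sigma> (v i)}) ` {..<n}" unfolding C using wv v(1)
      by (intro image_cong) (auto simp: \<sigma>_def dest: bij_betwE)
    also have "\<dots> = (\<lambda>x. {x, \<sigma> x}) ` (v ` {..<n})" by (simp add: image_image)
    finally show ?thesis using v(1) by (simp add: bij_betw_def)
  qed
  ultimately show "C \<in> (\<lambda>\<sigma>. (\<lambda>x. {x, \<sigma> x}) ` {..<n}) ` matchings G {..<n} {..<n}" by blast
qed

lemma num_hamilton_cycles_le: "num_hamilton_cycles n G \<le> card (matchings G {..<n} {..<n})"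
  unfolding num_hamilton_cycles_def
  by (rule order.trans[OF card_mono[OF _ hamilton_cycles_matching] card_image_le])
     (auto intro: finite_matchings)

section \<open>Systems of disjoint paths\<close>

definition path_system :: "nat \<Rightarrow> (nat \<Rightarrow> nat \<Rightarrow> bool) \<Rightarrow> nat list set \<Rightarrow> bool" where
  "path_system n G P \<longleftrightarrow> [] \<notin> P \<and> (\<forall>p\<in>P. distinct p \<and> successively G p) \<and>
     (\<forall>p\<in>P. \<forall>q\<in>P. p \<noteq> q \<longrightarrow> set p \<inter> set q = {}) \<and> \<Union> (set ` P) = {..<n}"

definition arcs :: "'a list set \<Rightarrow> ('a \<times> 'a) set" where
  "arcs P = {(x, y). \<exists>p\<in>P. adj p x y}"

lemma finite_path_systems: "finite {P. path_system n G P}"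
  by (rule finite_subset[of _ "Pow {xs. set xs \<subseteq> {..<n} \<and> distinct xs}"])
     (auto simp: path_system_def finite_subset_distinct)

lemma path_system_finite: "path_system n G P \<Longrightarrow> finite P"
  by (rule finite_subset[of _ "{xs. set xs \<subseteq> {..<n} \<and> distinct xs}"])
     (auto simp: path_system_def finite_subset_distinct)

lemma path_system_eqI:
  assumes "path_system n G P" "p \<in> P" "q \<in> P" "x \<in> set p" "x \<in> set q" shows "p = q"
  using assms unfolding path_system_def by (metis disjoint_iff)

lemma path_system_arcs_unique:
  assumes "path_system n G P" "(x, y) \<in> arcs P" "(x, z) \<in> arcs P" shows "y = z"
proof -
  from assms obtain p q where pq: "p \<in> P" "q \<in> P" "adj p x y" "adj q x z" by (auto simp: arcs_def)
  have "p = q" using path_system_eqI[OF assms(1) pq(1,2), of x] adj_in_set[OF pq(3)] adj_in_set[OF pq(4)] by simp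
  moreover have "distinct q" using assms(1) pq(2) by (simp add: path_system_def)
  ultimately show ?thesis using pq(3,4) adj_right_unique by metis
qed

lemma path_system_merge:
  assumes "path_system n G P" "p \<in> P" "q \<in> P" "p \<noteq> q" "G (last p) (hd q)"
  defines "P' \<equiv> insert (p @ q) (P - {p, q})"
  shows "path_system n G P'" "card P = Suc (card P')" "arcs P \<subseteq> arcs P'" "(last p, hd q) \<in> arcs P'"
proof -
  have ne: "p \<noteq> []" "q \<noteq> []" using assms by (auto simp: path_system_def)
  have disj: "set p \<inter> set q = {}" using assms by (auto simp: path_system_def)
  have dr: "set r \<inter> set (p @ q) = {}" if "r \<in> P - {p, q}" for r
    using that assms(1-3) unfolding path_system_def by auto
  show "path_system n G P'" unfolding path_system_def
  proof (intro conjI ballI impI)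
    show "[] \<notin> P'" using assms(1) ne by (auto simp: P'_def path_system_def)
    show "distinct r" "successively G r" if "r \<in> P'" for r
      using that assms(1-5) disj ne by (auto simp: P'_def path_system_def successively_append_iff)
    show "set r \<inter> set t = {}" if "r \<in> P'" "t \<in> P'" "r \<noteq> t" for r t
    proof -
      have "set r \<inter> set t = {}" if "r \<in> P" "t \<in> P"
        using that \<open>r \<noteq> t\<close> assms(1) unfolding path_system_def by blast
      then show ?thesis using that dr[of r] dr[of t] unfolding P'_def by blast
    qed
    have "\<Union> (set ` P') = \<Union> (set ` P)" using assms(2,3) by (auto simp: P'_def)
    then show "\<Union> (set ` P') = {..<n}" using assms(1) by (simp add: path_system_def)
  qed
  have fin: "finite P" using path_system_finite[OF assms(1)] .
  have "p @ q \<notin> P - {p, q}" using dr[of "p @ q"] ne by auto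
  then have "card P' = Suc (card (P - {p, q}))" using fin by (simp add: P'_def)
  also have "card (P - {p, q}) = card P - 2" using assms(2-4) fin by (subst card_Diff_subset) auto
  finally show "card P = Suc (card P')"
    using card_mono[OF fin, of "{p, q}"] assms(2-4) by auto
  show "arcs P \<subseteq> arcs P'" unfolding arcs_def P'_def by (auto simp: adj_append)
  show "(last p, hd q) \<in> arcs P'" using ne unfolding arcs_def P'_def by (auto simp: adj_append)
qed

text \<open>Left inverse of \<open>concat\<close> up to order, once the lengths of the parts are
  recorded.\<close>

fun pieces :: "nat list \<Rightarrow> 'a list \<Rightarrow> 'a list set" where
  "pieces [] xs = {}"
| "pieces (l # ls) xs = insert (take l xs) (pieces ls (drop l xs))"

lemma pieces_concat: "pieces (map length ps) (concat ps) = set ps"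
  by (induction ps) auto

lemma red_concat_le: "(\<forall>p\<in>set ps. successively G p) \<Longrightarrow> red G (concat ps) \<le> length ps"
proof (induction ps)
  case (Cons p ps)
  then have "red G p = 0" "red G (concat ps) \<le> length ps" by (auto simp: red_eq_0_iff)
  then show ?case by (simp add: red_append)
qed simp

section \<open>Hamilton paths with few non-edges, and Hamilton cycles as lists\<close>

definition ham_paths :: "nat \<Rightarrow> (nat \<Rightarrow> nat \<Rightarrow> bool) \<Rightarrow> nat \<Rightarrow> nat list set" where
  "ham_paths n G r = {xs. distinct xs \<and> set xs = {..<n} \<and> red G xs \<le> r}"

definition ham_lists :: "nat \<Rightarrow> (nat \<Rightarrow> nat \<Rightarrow> bool) \<Rightarrow> nat list set" where
  "ham_lists n G = {xs. distinct xs \<and> set xs = {..<n} \<and> successively G xs \<and> G (last xs) (hd xs)}"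

lemma finite_ham_paths: "finite (ham_paths n G r)"
  by (rule finite_subset[of _ "{xs. set xs \<subseteq> {..<n} \<and> distinct xs}"])
     (auto simp: ham_paths_def finite_subset_distinct)

lemma finite_ham_lists: "finite (ham_lists n G)"
  by (rule finite_subset[of _ "{xs. set xs \<subseteq> {..<n} \<and> distinct xs}"])
     (auto simp: ham_lists_def finite_subset_distinct)

text \<open>Concatenate the paths in some order. Red pairs occur only at junctions, and the system
  is recovered from the list together with \<open>k\<close> lengths in \<open>{..n}\<close>.\<close>

lemma card_path_systems_le:
  "card {P. path_system n G P \<and> card P = k} \<le> (n + 1) ^ k * card (ham_paths n G k)"
proof -
  let ?L = "{ls. set ls \<subseteq> {..n} \<and> length ls = k}"
  have fin: "finite (?L \<times> ham_paths n G k)"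
    using finite_lists_length_eq[of "{..n}" k] finite_ham_paths by blast
  have "{P. path_system n G P \<and> card P = k} \<subseteq> (\<lambda>(ls, xs). pieces ls xs) ` (?L \<times> ham_paths n G k)"
  proof
    fix P assume "P \<in> {P. path_system n G P \<and> card P = k}"
    then have P: "path_system n G P" "card P = k" by auto
    obtain ps where ps: "set ps = P" "distinct ps"
      using finite_distinct_list[OF path_system_finite[OF P(1)]] by blast
    have len: "length ps = k" using ps P distinct_card by fastforce
    have sub: "set p \<subseteq> {..<n}" if "p \<in> P" for p using that P(1) unfolding path_system_def by blast
    have "length p \<le> n" if "p \<in> P" for p
      using that P(1) card_mono[OF _ sub[OF that]] distinct_card[of p] by (auto simp: path_system_def)
    then have "map length ps \<in> ?L" using len ps by auto
    moreover have "distinct (concat ps)"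
      using P(1) ps by (intro distinct_concat) (auto simp: path_system_def)
    moreover have "set (concat ps) = {..<n}" using P(1) ps by (simp add: path_system_def)
    moreover have "red G (concat ps) \<le> k"
      using red_concat_le[of ps G] P(1) ps len by (auto simp: path_system_def)
    ultimately show "P \<in> (\<lambda>(ls, xs). pieces ls xs) ` (?L \<times> ham_paths n G k)"
      using ps(1) by (intro image_eqI[of _ _ "(map length ps, concat ps)"])
        (auto simp: pieces_concat ham_paths_def)
  qed
  then have "card {P. path_system n G P \<and> card P = k} \<le> card (?L \<times> ham_paths n G k)"
    using fin by (meson card_image_le card_mono finite_imageI le_trans)
  then show ?thesis by (simp add: card_cartesian_product card_lists_length_eq)
qed

lemma nth_of_ham_lists:
  assumes "xs \<in> ham_lists n G"
  shows "length xs = n" "bij_betw ((!) xs) {..<n} {..<n}"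
    "\<And>i. i < n \<Longrightarrow> G (xs ! i) (xs ! ((i + 1) mod n))"
proof -
  from assms have xs: "distinct xs" "set xs = {..<n}" "successively G xs" "G (last xs) (hd xs)"
    by (auto simp: ham_lists_def)
  show len: "length xs = n" using xs(1,2) by (metis card_lessThan distinct_card)
  show "bij_betw ((!) xs) {..<n} {..<n}" using bij_betw_nth[OF xs(1)] xs(2) len by simp
  show "G (xs ! i) (xs ! ((i + 1) mod n))" if "i < n" for i
  proof (cases "i + 1 = n")
    case True
    then have "xs \<noteq> []" "length xs - 1 = i" "(i + 1) mod n = 0" using len by auto
    then show ?thesis using xs(4) by (simp add: last_conv_nth hd_conv_nth)
  next
    case False
    then show ?thesis using that xs(3) len by (simp add: successively_conv_nth)
  qed
qed

text \<open>The first two vertices fix a starting point and a direction; afterwards each vertex is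
  the other neighbour, along the cycle, of the vertex before it.\<close>

lemma ham_list_determined:
  fixes xs ys :: "nat list"
  assumes "distinct xs" "distinct ys" "length xs = n" "length ys = n" "n \<ge> 3"
    "xs ! 0 = ys ! 0" "xs ! 1 = ys ! 1"
    "(\<lambda>i. {xs ! i, xs ! ((i + 1) mod n)}) ` {..<n} = (\<lambda>i. {ys ! i, ys ! ((i + 1) mod n)}) ` {..<n}"
  shows "xs = ys"
proof -
  have "i < n \<Longrightarrow> xs ! i = ys ! i" for i
  proof (induction i rule: less_induct)
    case (less i)
    consider "i = 0" | "i = 1" | "i \<ge> 2" by linarith
    then show ?case
    proof cases
      case 3
      define k where "k = i - 1"
      have k: "i = k + 1" "k \<ge> 1" "k < n" using 3 less.prems by (auto simp: k_def)
      have xk: "xs ! k = ys ! k" "xs ! (k - 1) = ys ! (k - 1)" using less k by auto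
      have "{xs ! k, xs ! i} \<in> (\<lambda>i. {xs ! i, xs ! ((i + 1) mod n)}) ` {..<n}"
        using k less.prems by (intro image_eqI[of _ _ k]) auto
      then obtain j where j: "j < n" "{xs ! k, xs ! i} = {ys ! j, ys ! ((j + 1) mod n)}"
        using assms(8) by auto
      have neq: "xs ! k \<noteq> xs ! i" using nth_eq_iff_index_eq[OF assms(1)] assms(3) k less.prems by auto
      have jn: "(j + 1) mod n < n" using j by simp
      have "ys ! k = ys ! j \<or> ys ! k = ys ! ((j + 1) mod n)" using j xk by (auto simp: doubleton_eq_iff)
      then have "k = j \<or> k = (j + 1) mod n"
        using nth_eq_iff_index_eq[OF assms(2)] assms(4) k(3) j(1) jn by auto
      then show ?thesis
      proof
        assume "k = j"
        then show ?thesis using j xk(1) k less.prems neq by (auto simp: doubleton_eq_iff)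
      next
        \<comment> \<open>Here the edge leads backwards in \<open>ys\<close>, which would make
          \<open>xs\<close> return to its vertex at \<open>k - 1\<close>. A wrap-around is
          impossible because it would give \<open>k = 0\<close>.\<close>
        assume kj: "k = (j + 1) mod n"
        have "j = k - 1"
        proof (cases "j + 1 = n")
          case True then show ?thesis using kj k by simp
        next
          case False then show ?thesis using kj j by simp
        qed
        then have "xs ! i = xs ! (k - 1)" using j xk kj neq by (auto simp: doubleton_eq_iff)
        then show ?thesis using nth_eq_iff_index_eq[OF assms(1)] assms(3) k less.prems by auto
      qed
    qed (use assms in auto)
  qed
  then show ?thesis using assms by (intro nth_equalityI) auto
qed

text \<open>A list is determined by its cycle and its first two vertices.\<close>

lemma card_ham_lists_le:
  assumes "n \<ge> 3" shows "card (ham_lists n G) \<le> n\<^sup>2 * num_hamilton_cycles n G"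
proof -
  define cyc where "cyc xs = (\<lambda>i. {xs ! i, xs ! ((i + 1) mod n)}) ` {..<n}" for xs :: "nat list"
  let ?f = "\<lambda>xs. ((xs ! 0, xs ! 1), cyc xs)"
  have "inj_on ?f (ham_lists n G)"
  proof (rule inj_onI)
    fix xs ys assume xy: "xs \<in> ham_lists n G" "ys \<in> ham_lists n G" "?f xs = ?f ys"
    have "distinct xs" "distinct ys" using xy by (auto simp: ham_lists_def)
    then show "xs = ys"
      using ham_list_determined[of xs ys n] nth_of_ham_lists(1)[OF xy(1)] nth_of_ham_lists(1)[OF xy(2)]
        assms xy(3) by (simp add: cyc_def)
  qed
  moreover have "?f ` ham_lists n G \<subseteq> ({..<n} \<times> {..<n}) \<times> hamilton_cycles n G"
  proof
    fix t assume "t \<in> ?f ` ham_lists n G"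
    then obtain xs where xs: "xs \<in> ham_lists n G" "t = ?f xs" by blast
    have "cyc xs \<in> hamilton_cycles n G"
      unfolding hamilton_cycles_def cyc_def using nth_of_ham_lists[OF xs(1)] by blast
    then show "t \<in> ({..<n} \<times> {..<n}) \<times> hamilton_cycles n G"
      using xs bij_betwE[OF nth_of_ham_lists(2)[OF xs(1)]] assms by auto
  qed
  moreover have "finite (hamilton_cycles n G)"
    using hamilton_cycles_matching by (rule finite_subset) (auto intro: finite_matchings)
  ultimately have "card (ham_lists n G) \<le> card (({..<n} \<times> {..<n}) \<times> hamilton_cycles n G)"
    by (intro card_inj_on_le[of ?f]) auto
  then show ?thesis by (simp add: card_cartesian_product power2_eq_square num_hamilton_cycles_def)
qed

section \<open>Counting matchings and path systems by mixing\<close>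

context pseudorandom
begin

text \<open>For sets of equal size \<open>m\<close> the mixing error is \<open>m * \<mu>\<close>,
  that is \<open>\<mu>\<close> per row on average, and some row lies on either side of the
  average.\<close>

lemma exists_below_average:
  assumes "R \<subseteq> {..<n}" "S \<subseteq> {..<n}" "card R = m" "card S = m" "m > 0"
  shows "\<exists>i\<in>R. card {y \<in> S. G i y} \<le> d * m / n + \<mu>"
    and "\<exists>i\<in>R. d * m / n - \<mu> \<le> card {y \<in> S. G i y}"
proof -
  have fin: "finite R" "R \<noteq> {}" using assms card_gt_0_iff by blast+
  have e: "\<bar>edge_count G R S - m * (d * m / n)\<bar> \<le> m * \<mu>"
    using mixing[OF assms(1,2)] assms(3,4) by (simp add: algebra_simps)
  show "\<exists>i\<in>R. card {y \<in> S. G i y} \<le> d * m / n + \<mu>"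
  proof (rule ccontr)
    assume "\<not> ?thesis"
    then have "(\<Sum>i\<in>R. d * m / n + \<mu>) < edge_count G R S"
      unfolding edge_count_def using fin by (intro sum_strict_mono) auto
    then show False using e assms(3) by (simp add: algebra_simps)
  qed
  show "\<exists>i\<in>R. d * m / n - \<mu> \<le> card {y \<in> S. G i y}"
  proof (rule ccontr)
    assume "\<not> ?thesis"
    then have "edge_count G R S < (\<Sum>i\<in>R. d * m / n - \<mu>)"
      unfolding edge_count_def using fin by (intro sum_strict_mono) auto
    then show False using e assms(3) by (simp add: algebra_simps)
  qed
qed

text \<open>Expanding along the row with the fewest available columns replaces Bregman's bound.\<close>
lemma card_matchings_le:
  assumes "R \<subseteq> {..<n}" "S \<subseteq> {..<n}" "card R = m" "card S = m"
  shows "card (matchings G R S) \<le> (\<Prod>j=1..m. d * real j / n + \<mu>)"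
  using assms
proof (induction m arbitrary: R S)
  case 0
  then have "R = {}" "S = {}" using finite_subset[OF _ finite_lessThan] card_0_eq by metis+
  then have "matchings G R S \<subseteq> {\<lambda>_. undefined}" by (auto simp: matchings_def)
  then have "card (matchings G R S) \<le> card {\<lambda>_ :: nat. undefined :: nat}" by (intro card_mono) auto
  then show ?case by simp
next
  case (Suc m)
  have fin: "finite R" "finite S" using Suc.prems finite_subset by auto
  obtain i where i: "i \<in> R" "card {y \<in> S. G i y} \<le> d * Suc m / n + \<mu>"
    using exists_below_average(1)[OF Suc.prems] by auto
  let ?p = "\<Prod>j=1..m. d * real j / n + \<mu>"
  have "card (matchings G R S) \<le> (\<Sum>y\<in>{y \<in> S. G i y}. card (matchings G (R - {i}) (S - {y})))"
    by (rule card_matchings_step[OF fin i(1)])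
  then have "real (card (matchings G R S)) \<le> (\<Sum>y\<in>{y \<in> S. G i y}. real (card (matchings G (R - {i}) (S - {y}))))"
    by (simp only: of_nat_sum[symmetric] of_nat_le_iff)
  also have "\<dots> \<le> (\<Sum>y\<in>{y \<in> S. G i y}. ?p)"
    using Suc.prems i(1) fin by (intro sum_mono Suc.IH) auto
  also have "\<dots> = card {y \<in> S. G i y} * ?p" by simp
  also have "\<dots> \<le> (d * Suc m / n + \<mu>) * ?p"
    using i(2) d_pos mu_pos by (intro mult_right_mono prod_nonneg) (auto intro!: add_nonneg_nonneg)
  finally show ?case by (simp add: mult.commute)
qed

text \<open>The path to be extended is chosen by the state alone, so different continuations stay
  distinguishable by their arcs.\<close>
lemma card_path_systems_ge:
  assumes "path_system n G P" "card P = k + t" "\<mu> + 1 \<le> d * k / n"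
  shows "(\<Prod>j=k+1..k+t. d * real j / n - \<mu> - 1) \<le> card {Q. path_system n G Q \<and> card Q = k \<and> arcs P \<subseteq> arcs Q}"
  using assms(1,2)
proof (induction t arbitrary: P)
  case 0
  then have "P \<in> {Q. path_system n G Q \<and> card Q = k \<and> arcs P \<subseteq> arcs Q}" by auto
  then have "card {Q. path_system n G Q \<and> card Q = k \<and> arcs P \<subseteq> arcs Q} > 0"
    by (subst card_gt_0_iff) (auto intro: finite_subset[OF _ finite_path_systems])
  then show ?case by simp
next
  case (Suc t)
  let ?m = "k + Suc t"
  let ?F = "\<lambda>P. {Q. path_system n G Q \<and> card Q = k \<and> arcs P \<subseteq> arcs Q}"
  let ?prod = "\<Prod>j=k+1..k+t. d * real j / n - \<mu> - 1"
  have finP: "finite P" using path_system_finite[OF Suc.prems(1)] .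
  have ne: "p \<noteq> []" if "p \<in> P" for p using that Suc.prems by (auto simp: path_system_def)
  have "inj_on hd P"
  proof (rule inj_onI)
    fix p q assume "p \<in> P" "q \<in> P" "hd p = hd q"
    then show "p = q" using path_system_eqI[OF Suc.prems(1), of p q "hd p"] hd_in_set ne by metis
  qed
  moreover have "inj_on last P"
  proof (rule inj_onI)
    fix p q assume "p \<in> P" "q \<in> P" "last p = last q"
    then show "p = q" using path_system_eqI[OF Suc.prems(1), of p q "last p"] last_in_set ne by metis
  qed
  ultimately have inj: "inj_on hd P" "inj_on last P" .
  have "set p \<subseteq> {..<n}" if "p \<in> P" for p using that Suc.prems(1) unfolding path_system_def by blast
  then have sub: "last ` P \<subseteq> {..<n}" "hd ` P \<subseteq> {..<n}"
    using ne hd_in_set last_in_set by blast+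
  have "\<exists>i\<in>last ` P. d * ?m / n - \<mu> \<le> card {y \<in> hd ` P. G i y}"
    by (rule exists_below_average(2)[OF sub]) (simp_all add: card_image inj Suc.prems)
  then obtain p where p: "p \<in> P" "d * ?m / n - \<mu> \<le> card {y \<in> hd ` P. G (last p) y}" by blast
  \<comment> \<open>Joining \<open>p\<close> to its own start would close a cycle. Excluding it
    accounts for the 1 subtracted in each factor.\<close>
  define J where "J = {q \<in> P. q \<noteq> p \<and> G (last p) (hd q)}"
  have finJ: "finite J" using finP by (simp add: J_def)
  have "{y \<in> hd ` P. G (last p) y} \<subseteq> insert (hd p) (hd ` J)" by (auto simp: J_def)
  then have "card {y \<in> hd ` P. G (last p) y} \<le> card (insert (hd p) (hd ` J))"
    using finJ by (intro card_mono) auto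
  also have "\<dots> \<le> card J + 1"
    using card_insert_le_m1 card_image_le[OF finJ, of hd] finJ by (simp add: card_insert_if)
  finally have J: "d * ?m / n - \<mu> - 1 \<le> card J" using p(2) by linarith
  define ext where "ext q = insert (p @ q) (P - {p, q})" for q
  have ext: "path_system n G (ext q)" "card (ext q) = k + t" "arcs P \<subseteq> arcs (ext q)"
    "(last p, hd q) \<in> arcs (ext q)" if "q \<in> J" for q
    using path_system_merge[OF Suc.prems(1) p(1), of q] that Suc.prems(2)
    by (auto simp: J_def ext_def)
  have fin: "finite (?F P)" for P by (rule finite_subset[OF _ finite_path_systems]) auto
  have nn: "0 \<le> ?prod"
  proof (rule prod_nonneg)
    fix j assume "j \<in> {k+1..k+t}"
    then have "d * k / n \<le> d * real j / n" using d_pos by (intro divide_right_mono mult_left_mono) auto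
    then show "0 \<le> d * real j / n - \<mu> - 1" using assms(3) by linarith
  qed
  have "(d * ?m / n - \<mu> - 1) * ?prod \<le> card J * ?prod" by (rule mult_right_mono[OF J nn])
  also have "\<dots> = (\<Sum>q\<in>J. ?prod)" by simp
  also have "\<dots> \<le> (\<Sum>q\<in>J. real (card (?F (ext q))))"
    using ext by (intro sum_mono Suc.IH) auto
  also have "\<dots> = card (\<Union>q\<in>J. ?F (ext q))"
  proof -
    have "?F (ext q) \<inter> ?F (ext r) = {}" if "q \<in> J" "r \<in> J" "q \<noteq> r" for q r
    proof -
      have "hd q \<noteq> hd r" using that inj(1) by (auto simp: J_def inj_on_def)
      then show ?thesis using path_system_arcs_unique ext(4)[OF that(1)] ext(4)[OF that(2)] by blast
    qed
    then show ?thesis using finJ fin by (subst card_UN_disjoint) auto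
  qed
  also have "\<dots> \<le> card (?F P)"
    using ext(3) fin by (intro of_nat_mono card_mono) blast+
  finally show ?case by (simp add: mult.commute)
qed

lemma card_path_systems_ge':
  assumes "\<mu> + 1 \<le> d * k / n" "k \<le> n"
  shows "(\<Prod>j=k+1..n. d * real j / n - \<mu> - 1) \<le> card {Q. path_system n G Q \<and> card Q = k}"
proof -
  define P where "P = (\<lambda>x. [x]) ` {..<n}"
  have P: "path_system n G P" by (auto simp: P_def path_system_def)
  have "card P = k + (n - k)" using assms(2) by (simp add: P_def card_image inj_on_def)
  from card_path_systems_ge[OF P this assms(1)]
  have "(\<Prod>j=k+1..k+(n-k). d * real j / n - \<mu> - 1) \<le>
      card {Q. path_system n G Q \<and> card Q = k \<and> arcs P \<subseteq> arcs Q}" .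
  also have "\<dots> \<le> card {Q. path_system n G Q \<and> card Q = k}"
    by (intro of_nat_mono card_mono) (auto intro: finite_subset[OF _ finite_path_systems])
  finally show ?thesis using assms(2) by simp
qed

lemma upper_bound: "num_hamilton_cycles n G \<le> (\<Prod>j=1..n. d * real j / n + \<mu>)"
proof -
  have "card (matchings G {..<n} {..<n}) \<le> (\<Prod>j=1..n. d * real j / n + \<mu>)"
    by (rule card_matchings_le) auto
  then show ?thesis using num_hamilton_cycles_le[of n G] by linarith
qed

text \<open>The exponent of \<open>n + 1\<close> adds up three losses: \<open>k\<close> for the
  lengths of the paths, \<open>(k + 1) * (4 * \<rho> + 6)\<close> for undoing the reversals, and 2
  for the first two vertices of a listed cycle.\<close>

lemma lower_bound:
  assumes "s = 2 * \<rho> + 3" "n \<le> 2 ^ \<rho>" "16 * s \<le> n" "100 * \<mu> * s \<le> d" "\<mu> + 1 \<le> d * k / n" "k \<le> n"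
  shows "(\<Prod>j=k+1..n. d * real j / n - \<mu> - 1) \<le>
    real (n + 1) ^ (k + (k + 1) * (4 * \<rho> + 6) + 2) * num_hamilton_cycles n G"
proof -
  define T where "T = (k + 1) * (4 * \<rho> + 6)"
  have "ham_paths n G k \<subseteq> (\<Union>ys\<in>ham_lists n G. {xs. (suffix_rev ^^ T) xs ys})"
  proof
    fix xs assume "xs \<in> ham_paths n G k"
    then have xs: "distinct xs" "set xs = {..<n}" "red G xs \<le> k" by (auto simp: ham_paths_def)
    then obtain ys where ys: "(suffix_rev ^^ T) xs ys" "successively G ys" "G (last ys) (hd ys)"
      using ham_cycle_near_path[OF assms(1-4)] unfolding T_def by blast
    have "mset ys = mset xs" using suffix_rev_power_perm[OF ys(1)] .
    then have "distinct ys" "set ys = {..<n}"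
      using xs mset_eq_imp_distinct_iff by blast (metis xs(2) \<open>mset ys = mset xs\<close> set_mset_mset)
    then show "xs \<in> (\<Union>ys\<in>ham_lists n G. {xs. (suffix_rev ^^ T) xs ys})"
      using ys by (auto simp: ham_lists_def)
  qed
  then have "card (ham_paths n G k) \<le> card (\<Union>ys\<in>ham_lists n G. {xs. (suffix_rev ^^ T) xs ys})"
    by (intro card_mono finite_UN_I finite_ham_lists conjunct1[OF card_suffix_rev_power_preimage])
  also have "\<dots> \<le> (\<Sum>ys\<in>ham_lists n G. card {xs. (suffix_rev ^^ T) xs ys})"
    by (rule card_UN_le[OF finite_ham_lists])
  also have "\<dots> \<le> (\<Sum>ys\<in>ham_lists n G. (n + 1) ^ T)"
  proof (rule sum_mono)
    fix ys assume "ys \<in> ham_lists n G"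
    then show "card {xs. (suffix_rev ^^ T) xs ys} \<le> (n + 1) ^ T"
      using conjunct2[OF card_suffix_rev_power_preimage[of T ys]] nth_of_ham_lists(1)[of ys n G] by simp
  qed
  also have "\<dots> = (n + 1) ^ T * card (ham_lists n G)" by simp
  also have "\<dots> \<le> (n + 1) ^ T * (n\<^sup>2 * num_hamilton_cycles n G)"
    using assms(1,3) by (intro mult_left_mono card_ham_lists_le) auto
  also have "\<dots> \<le> (n + 1) ^ T * ((n + 1)\<^sup>2 * num_hamilton_cycles n G)"
    by (intro mult_left_mono mult_right_mono power_mono) auto
  finally have 1: "card (ham_paths n G k) \<le> (n + 1) ^ T * ((n + 1)\<^sup>2 * num_hamilton_cycles n G)" .
  have "card {Q. path_system n G Q \<and> card Q = k} \<le> (n + 1) ^ k * card (ham_paths n G k)"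
    by (rule card_path_systems_le)
  also have "\<dots> \<le> (n + 1) ^ k * ((n + 1) ^ T * ((n + 1)\<^sup>2 * num_hamilton_cycles n G))"
    by (rule mult_left_mono[OF 1]) simp
  also have "\<dots> = (n + 1) ^ (k + T + 2) * num_hamilton_cycles n G"
    by (simp only: power_add mult.assoc)
  finally have "real (card {Q. path_system n G Q \<and> card Q = k}) \<le>
      real ((n + 1) ^ (k + T + 2) * num_hamilton_cycles n G)" by (simp only: of_nat_le_iff)
  then show ?thesis using card_path_systems_ge'[OF assms(5,6)] by (simp add: T_def)
qed

end

section \<open>Spectral decomposition and mixing\<close>

lemma index_mult_mat_sum:
  assumes "X \<in> carrier_mat n n" "Y \<in> carrier_mat n n" "i < n" "j < n"
  shows "(X * Y) $$ (i, j) = (\<Sum>k<n. X $$ (i, k) * Y $$ (k, j))"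
  using assms by (simp add: scalar_prod_def lessThan_atLeast0)

text \<open>A complex eigenvector \<open>z\<close> exists. Its eigenvalue is real by symmetry, so
  the real and the imaginary part of \<open>z\<close> satisfy the same equation, and one of them is
  nonzero.\<close>

lemma symmetric_has_unit_eigenvector:
  fixes A :: "real mat"
  assumes A: "A \<in> carrier_mat n n" "A\<^sup>T = A" and "n > 0"
  shows "\<exists>e v. (\<Sum>i<n. (v i)\<^sup>2) = 1 \<and> (\<forall>i<n. (\<Sum>j<n. A $$ (i, j) * v j) = e * v i)"
proof -
  define B where "B = map_mat complex_of_real A"
  have B: "B \<in> carrier_mat n n" using A by (simp add: B_def)
  have sym: "A $$ (i, j) = A $$ (j, i)" if "i < n" "j < n" for i j
    using A that by (metis carrier_matD index_transpose_mat(1))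
  obtain c where "eigenvalue B c"
    using spectrum_non_empty[OF B] assms(3) unfolding spectrum_def by auto
  then obtain z where z: "z \<in> carrier_vec n" "z \<noteq> 0\<^sub>v n" "B *\<^sub>v z = c \<cdot>\<^sub>v z"
    unfolding eigenvalue_def eigenvector_def using B by auto
  have eq: "(\<Sum>j<n. complex_of_real (A $$ (i, j)) * z $ j) = c * z $ i" if "i < n" for i
  proof -
    have "(B *\<^sub>v z) $ i = (\<Sum>j<n. complex_of_real (A $$ (i, j)) * z $ j)"
      using that A z(1) by (simp add: B_def scalar_prod_def lessThan_atLeast0)
    then show ?thesis using z that by simp
  qed
  obtain i0 where i0: "i0 < n" "z $ i0 \<noteq> 0"
    using z(1,2) by (metis carrier_vecD eq_vecI index_zero_vec(1) index_zero_vec(2))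
  define N where "N = (\<Sum>i<n. (cmod (z $ i))\<^sup>2)"
  have "(cmod (z $ i0))\<^sup>2 \<le> N" unfolding N_def by (rule member_le_sum) (use i0 in auto)
  then have N: "N > 0" using i0 by (smt (verit) norm_eq_zero zero_less_power2)
  \<comment> \<open>The Hermitian form at \<open>z\<close>: the eigenvalue equation gives
    \<open>c * N\<close>, and symmetry makes it equal to its conjugate.\<close>
  define q where "q = (\<Sum>i<n. \<Sum>j<n. complex_of_real (A $$ (i, j)) * z $ j * cnj (z $ i))"
  have "q = (\<Sum>i<n. c * z $ i * cnj (z $ i))" unfolding q_def
    by (intro sum.cong refl) (simp add: sum_distrib_right[symmetric] eq)
  also have "\<dots> = c * N"
    by (simp add: N_def sum_distrib_left mult.assoc complex_norm_square del: of_real_power)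
  finally have q: "q = c * N" .
  have "cnj q = (\<Sum>i<n. \<Sum>j<n. complex_of_real (A $$ (i, j)) * z $ i * cnj (z $ j))"
    by (simp add: q_def mult_ac)
  also have "\<dots> = (\<Sum>j<n. \<Sum>i<n. complex_of_real (A $$ (i, j)) * z $ i * cnj (z $ j))"
    by (rule sum.swap)
  also have "\<dots> = q" unfolding q_def by (intro sum.cong refl) (simp add: sym)
  finally have "cnj q = q" .
  then have "cnj c * N = c * N" by (simp add: q)
  then have "cnj c = c" using N by simp
  then have c: "c = complex_of_real (Re c)" by (metis complex_cnj_cancel_iff Reals_cnj_iff complex_is_Real_iff of_real_Re)
  have re: "(\<Sum>j<n. A $$ (i, j) * Re (z $ j)) = Re c * Re (z $ i)"
    and im: "(\<Sum>j<n. A $$ (i, j) * Im (z $ j)) = Re c * Im (z $ i)" if "i < n" for i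
    using arg_cong[OF eq[OF that], of Re] arg_cong[OF eq[OF that], of Im] c
    by (simp_all add: complex_eq_iff)
  obtain x where x: "x i0 \<noteq> 0" "\<And>i. i < n \<Longrightarrow> (\<Sum>j<n. A $$ (i, j) * x j) = Re c * x i"
  proof (cases "Re (z $ i0) = 0")
    case True
    then have "Im (z $ i0) \<noteq> 0" using i0 by (simp add: complex_eq_iff)
    then show ?thesis using that[of "\<lambda>i. Im (z $ i)"] im by blast
  next
    case False then show ?thesis using that[of "\<lambda>i. Re (z $ i)"] re by blast
  qed
  define M where "M = (\<Sum>i<n. (x i)\<^sup>2)"
  have "(x i0)\<^sup>2 \<le> M" unfolding M_def by (rule member_le_sum) (use i0 in auto)
  then have M: "M > 0" using x(1) by (smt (verit) zero_less_power2)
  define v where "v i = x i / sqrt M" for i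
  have "(\<Sum>i<n. (v i)\<^sup>2) = 1"
    using M by (simp add: v_def power_divide sum_divide_distrib[symmetric] M_def[symmetric])
  moreover have "(\<Sum>j<n. A $$ (i, j) * v j) = Re c * v i" if "i < n" for i
    using x(2)[OF that] by (simp add: v_def sum_divide_distrib[symmetric])
  ultimately show ?thesis by blast
qed

text \<open>A Householder reflection.\<close>
lemma orthogonal_with_first_column:
  fixes v :: "nat \<Rightarrow> real"
  assumes "(\<Sum>i<n. (v i)\<^sup>2) = 1" "n > 0"
  shows "\<exists>H \<in> carrier_mat n n. H\<^sup>T = H \<and> H * H = 1\<^sub>m n \<and> (\<forall>i<n. H $$ (i, 0) = v i)"
\<comment> \<open>If \<open>v\<close> is the first unit vector, the reflection direction
  \<open>w\<close> vanishes, so the identity matrix is taken instead.\<close>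
proof (cases "\<forall>i<n. v i = (if i = 0 then 1 else 0)")
  case True
  then show ?thesis using assms(2) by (intro bexI[of _ "1\<^sub>m n"]) auto
next
  case False
  define w where "w i = v i - (if i = 0 then 1 else 0)" for i
  define c where "c = (\<Sum>i<n. (w i)\<^sup>2)"
  from False obtain i0 where i0: "i0 < n" "w i0 \<noteq> 0" unfolding w_def by auto
  have "(w i0)\<^sup>2 \<le> c" unfolding c_def by (rule member_le_sum) (use i0 in auto)
  then have c: "c > 0" using i0(2) by (smt (verit) zero_less_power2)
  \<comment> \<open>As \<open>v\<close> has norm 1, \<open>c\<close> equals
    \<open>- 2 * w 0\<close>; so the first column of \<open>H\<close> is the first unit vector plus
    \<open>w\<close>, which is \<open>v\<close>.\<close>
  have "c = (\<Sum>i<n. (v i)\<^sup>2 - 2 * (if i = 0 then v i else 0) + (if i = 0 then 1 else 0))"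
    unfolding c_def w_def by (intro sum.cong refl) (auto simp: power2_eq_square algebra_simps)
  also have "\<dots> = 2 - 2 * v 0"
    using assms by (simp add: sum.distrib sum_subtractf sum_distrib_left[symmetric] sum.delta)
  finally have c2: "c = - 2 * w 0" by (simp add: w_def)
  define H where "H = mat n n (\<lambda>(i, j). (if i = j then 1 else 0) - 2 * w i * w j / c)"
  have H: "H \<in> carrier_mat n n" by (simp add: H_def)
  have cc: "(\<Sum>k<n. b * (w k)\<^sup>2) = b * c" for b by (simp add: c_def sum_distrib_left)
  have "H * H = 1\<^sub>m n"
  proof (rule eq_matI)
    fix i j assume "i < dim_row (1\<^sub>m n :: real mat)" "j < dim_col (1\<^sub>m n :: real mat)"
    then have ij: "i < n" "j < n" by auto
    have "(H * H) $$ (i, j) = (\<Sum>k<n. ((if i = k then 1 else 0) - 2 * w i * w k / c) *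
        ((if k = j then 1 else 0) - 2 * w k * w j / c))"
      using ij by (simp add: index_mult_mat_sum[OF H H]) (simp add: H_def)
    also have "\<dots> = (\<Sum>k<n. (if k = i then (if i = j then 1 else 0) - 2 * w i * w j / c else 0)
        - (if k = j then 2 * w i * w j / c else 0) + 4 * w i * w j / (c * c) * (w k)\<^sup>2)"
      by (intro sum.cong refl) (auto simp: power2_eq_square algebra_simps)
    also have "\<dots> = (if i = j then 1 else 0) - 2 * w i * w j / c - 2 * w i * w j / c + 4 * w i * w j / (c * c) * c"
      using ij unfolding sum.distrib sum_subtractf cc by simp
    also have "\<dots> = (1\<^sub>m n) $$ (i, j)" using c ij by simp
    finally show "(H * H) $$ (i, j) = (1\<^sub>m n) $$ (i, j)" .
  qed (use H in auto)
  moreover have "H\<^sup>T = H" by (rule eq_matI) (auto simp: H_def)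
  moreover have "H $$ (i, 0) = v i" if "i < n" for i
  proof -
    have "w 0 = - c / 2" using c2 by simp
    then have "H $$ (i, 0) = (if i = 0 then 1 else 0) + w i" using that assms(2) c by (simp add: H_def)
    then show ?thesis by (simp add: w_def)
  qed
  ultimately show ?thesis using H by blast
qed

text \<open>Deflation: conjugating by a reflection whose first column is a unit eigenvector splits
  off a 1 by 1 block, and the induction hypothesis diagonalises the remaining symmetric
  block.\<close>

lemma symmetric_orthogonal_diagonalisation:
  fixes A :: "real mat"
  assumes "A \<in> carrier_mat n n" "A\<^sup>T = A"
  shows "\<exists>P D. P \<in> carrier_mat n n \<and> D \<in> carrier_mat n n \<and> diagonal_mat D \<and>
     P\<^sup>T * P = 1\<^sub>m n \<and> P\<^sup>T * A * P = D"
  using assms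
proof (induction n arbitrary: A)
  case 0
  then show ?case by (intro exI[of _ "1\<^sub>m 0"] exI[of _ A]) (auto simp: diagonal_mat_def)
next
  case (Suc m)
  let ?n = "Suc m"
  note A = Suc.prems
  obtain e v where v: "(\<Sum>i<?n. (v i)\<^sup>2) = 1" "\<And>i. i < ?n \<Longrightarrow> (\<Sum>j<?n. A $$ (i, j) * v j) = e * v i"
    using symmetric_has_unit_eigenvector[OF A] by auto
  obtain H where H: "H \<in> carrier_mat ?n ?n" "H\<^sup>T = H" "H * H = 1\<^sub>m ?n" "\<And>i. i < ?n \<Longrightarrow> H $$ (i, 0) = v i"
    using orthogonal_with_first_column[OF v(1)] by blast
  define A' where "A' = H * A * H"
  have HA: "H * A \<in> carrier_mat ?n ?n" "A * H \<in> carrier_mat ?n ?n" using H A by auto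
  have A': "A' \<in> carrier_mat ?n ?n" using HA H by (simp add: A'_def)
  have A'T: "A'\<^sup>T = A'"
    unfolding A'_def transpose_mult[OF HA(1) H(1)] transpose_mult[OF H(1) A(1)] H(2) A(2)
    by (rule assoc_mult_mat[OF H(1) A(1) H(1), symmetric])
  have AH: "(A * H) $$ (i, 0) = e * H $$ (i, 0)" if "i < ?n" for i
  proof -
    have "(A * H) $$ (i, 0) = (\<Sum>j<?n. A $$ (i, j) * H $$ (j, 0))"
      using that by (intro index_mult_mat_sum[OF A(1) H(1)]) auto
    also have "\<dots> = (\<Sum>j<?n. A $$ (i, j) * v j)" by (intro sum.cong refl) (simp add: H(4))
    finally show ?thesis using v(2)[OF that] H(4)[OF that] by simp
  qed
  have A'0: "A' $$ (i, 0) = (if i = 0 then e else 0)" if "i < ?n" for i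
  proof -
    have "A' = H * (A * H)" unfolding A'_def using assoc_mult_mat[OF H(1) A(1) H(1)] .
    then have "A' $$ (i, 0) = (\<Sum>j<?n. H $$ (i, j) * (A * H) $$ (j, 0))"
      using that index_mult_mat_sum[OF H(1) HA(2)] by simp
    also have "\<dots> = (\<Sum>j<?n. e * (H $$ (i, j) * H $$ (j, 0)))"
      by (intro sum.cong refl) (simp add: AH del: index_mult_mat)
    also have "\<dots> = e * (H * H) $$ (i, 0)"
      using that by (subst index_mult_mat_sum[OF H(1) H(1)]) (auto simp: sum_distrib_left simp del: sum.lessThan_Suc)
    finally show ?thesis using that H(3) by simp
  qed
  define E where "E = mat 1 1 (\<lambda>_. e)"
  define A3 where "A3 = mat m m (\<lambda>(i, j). A' $$ (Suc i, Suc j))"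
  have E: "E \<in> carrier_mat 1 1" and A3: "A3 \<in> carrier_mat m m" by (auto simp: E_def A3_def)
  have sym: "A' $$ (i, j) = A' $$ (j, i)" if "i < ?n" "j < ?n" for i j
    using A'T A' that by (metis carrier_matD index_transpose_mat(1))
  \<comment> \<open>The first column comes from the eigenvector equation, the first row then by
    symmetry.\<close>
  have blk: "A' = four_block_mat E (0\<^sub>m 1 m) (0\<^sub>m m 1) A3"
    using A' A'0 sym[of 0] by (intro eq_matI) (auto simp: E_def A3_def)
  have "A3\<^sup>T = A3" by (rule eq_matI) (auto simp: A3_def sym)
  from Suc.IH[OF A3 this] obtain P3 D3 where P3: "P3 \<in> carrier_mat m m" "D3 \<in> carrier_mat m m"
    "diagonal_mat D3" "P3\<^sup>T * P3 = 1\<^sub>m m" "P3\<^sup>T * A3 * P3 = D3" by blast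
  define F where "F = four_block_mat (1\<^sub>m 1) (0\<^sub>m 1 m) (0\<^sub>m m 1) P3"
  have "F \<in> carrier_mat (1 + m) (1 + m)"
    unfolding F_def by (rule four_block_carrier_mat) (use P3(1) in auto)
  then have F: "F \<in> carrier_mat ?n ?n" by simp
  have P3T: "P3\<^sup>T \<in> carrier_mat m m" using P3 by simp
  have FT: "F\<^sup>T = four_block_mat (1\<^sub>m 1) (0\<^sub>m 1 m) (0\<^sub>m m 1) (P3\<^sup>T)"
    unfolding F_def by (subst transpose_four_block_mat[of _ 1 1 _ m _ m]) (use P3 in auto)
  have FTc: "F\<^sup>T \<in> carrier_mat ?n ?n" using F by simp
  have FF: "F\<^sup>T * F = 1\<^sub>m ?n"
    unfolding FT unfolding F_def
    by (subst mult_four_block_mat[of _ 1 1 _ m _ m _ _ 1 _ m]) (use P3 P3T in \<open>auto simp: four_block_one_mat[of 1 m, simplified]\<close>)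
  have "F\<^sup>T * A' = four_block_mat E (0\<^sub>m 1 m) (0\<^sub>m m 1) (P3\<^sup>T * A3)"
    unfolding FT blk
    by (subst mult_four_block_mat[of _ 1 1 _ m _ m _ _ 1 _ m]) (use E A3 P3T in auto)
  then have FAF: "F\<^sup>T * A' * F = four_block_mat E (0\<^sub>m 1 m) (0\<^sub>m m 1) D3"
    unfolding F_def
    by (simp, subst mult_four_block_mat[of _ 1 1 _ m _ m _ _ 1 _ m]) (use E A3 P3 P3T in auto)
  define P where "P = H * F"
  define D where "D = four_block_mat E (0\<^sub>m 1 m) (0\<^sub>m m 1) D3"
  have P: "P \<in> carrier_mat ?n ?n" using H F by (simp add: P_def)
  have PT: "P\<^sup>T = F\<^sup>T * H" unfolding P_def using transpose_mult[OF H(1) F] H(2) by simp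
  have "P\<^sup>T * P = F\<^sup>T * (H * (H * F))"
    unfolding PT unfolding assoc_mult_mat[OF FTc H(1) P] unfolding P_def ..
  also have "H * (H * F) = F" using assoc_mult_mat[OF H(1) H(1) F] H(3) F by simp
  finally have PP: "P\<^sup>T * P = 1\<^sub>m ?n" using FF by simp
  have "P\<^sup>T * A * P = F\<^sup>T * H * A * (H * F)" unfolding PT unfolding P_def ..
  also have "\<dots> = F\<^sup>T * (H * A) * (H * F)" using assoc_mult_mat[OF FTc H(1) A(1)] by simp
  also have "\<dots> = F\<^sup>T * (H * A) * H * F"
    using assoc_mult_mat[OF mult_carrier_mat[OF FTc HA(1)] H(1) F] by simp
  also have "\<dots> = F\<^sup>T * A' * F" using assoc_mult_mat[OF FTc HA(1) H(1)] by (simp add: A'_def)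
  also have "\<dots> = D" unfolding FAF D_def ..
  finally have PAP: "P\<^sup>T * A * P = D" .
  have "D \<in> carrier_mat (1 + m) (1 + m)"
    unfolding D_def by (rule four_block_carrier_mat) (use E P3(2) in auto)
  then have "D \<in> carrier_mat ?n ?n" by simp
  moreover have "diagonal_mat D" using P3(2,3) E
    unfolding diagonal_mat_def D_def by (auto simp: diagonal_mat_def)
  ultimately show ?case using P PP PAP by blast
qed

lemma proots_linear_factors: "proots (\<Prod>a\<leftarrow>xs. [:- a, 1 :: 'a :: idom:]) = mset xs"
proof (induction xs)
  case (Cons a xs)
  have "(\<Prod>a\<leftarrow>xs. [:- a, 1 :: 'a:]) \<noteq> 0" by (auto simp: prod_list_zero_iff)
  then have "proots ([:- a, 1:] * (\<Prod>a\<leftarrow>xs. [:- a, 1:])) = proots [:- a, 1:] + mset xs"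
    using Cons by (subst proots_mult) auto
  then show ?case by simp
qed simp

text \<open>The diagonal matrix is similar to the adjacency matrix, so its entries are the roots of
  the characteristic polynomial with multiplicity. This ties the multiset of eigenvalues to an
  orthonormal eigenbasis.\<close>

lemma adjacency_spectral_decomposition:
  assumes G: "simple_graph_on n G" and n: "n > 0"
    and bound: "\<forall>x \<in># nontrivial_eigenvalues n G. \<bar>x\<bar> \<le> lam"
  shows "\<exists>P ev k0. k0 < n \<and> (\<forall>i<n. \<forall>j<n. (\<Sum>k<n. P i k * P j k) = (if i = j then 1 else 0)) \<and>
     (\<forall>i<n. \<forall>j<n. (\<Sum>k<n. ev k * (P i k * P j k)) = (if G i j then 1 else (0::real))) \<and>
     (\<forall>k<n. k \<noteq> k0 \<longrightarrow> \<bar>ev k\<bar> \<le> lam)"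
proof -
  define A where "A = adj_matrix n G"
  have A: "A \<in> carrier_mat n n" by (simp add: A_def adj_matrix_def)
  have "A\<^sup>T = A" using G by (intro eq_matI) (auto simp: A_def adj_matrix_def simple_graph_on_def)
  from symmetric_orthogonal_diagonalisation[OF A this]
  obtain P D where P: "P \<in> carrier_mat n n" and D: "D \<in> carrier_mat n n" "diagonal_mat D"
    and PP: "P\<^sup>T * P = 1\<^sub>m n" and PAP: "P\<^sup>T * A * P = D" by blast
  have PT: "P\<^sup>T \<in> carrier_mat n n" using P by simp
  have PP': "P * P\<^sup>T = 1\<^sub>m n" by (rule mat_mult_left_right_inverse[OF PT P PP])
  have PD: "P * D \<in> carrier_mat n n" using P D by simp
  have "P * D * P\<^sup>T = A"
  proof -
    have "P * D = P * (P\<^sup>T * (A * P))" unfolding PAP[symmetric] using assoc_mult_mat[OF PT A P] by simp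
    also have "\<dots> = A * P" using assoc_mult_mat[OF P PT, of "A * P" n] PP' A P by simp
    finally have "P * D * P\<^sup>T = A * (P * P\<^sup>T)" using assoc_mult_mat[OF A P PT] by simp
    then show ?thesis using PP' A by simp
  qed
  from similar_mat_witI[OF PP' PP this[symmetric] A D(1) P PT]
  have "similar_mat A D" unfolding similar_mat_def by blast
  then have "char_poly A = char_poly D" by (rule char_poly_similar)
  also have "\<dots> = (\<Prod>a\<leftarrow>diag_mat D. [:- a, 1:])"
    by (rule char_poly_upper_triangular[OF D(1)]) (use D in \<open>auto simp: upper_triangular_def diagonal_mat_def\<close>)
  finally have ms: "adj_eigenvalues n G = mset (diag_mat D)"
    by (simp add: adj_eigenvalues_def A_def[symmetric] proots_linear_factors)
  have len: "length (diag_mat D) = n" using D by (simp add: diag_mat_def)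
  define ev where "ev k = D $$ (k, k)" for k
  have evd: "ev k = diag_mat D ! k" if "k < n" for k using that D by (simp add: ev_def diag_mat_def)
  have "adj_eigenvalues n G \<noteq> {#}" using ms len n by auto
  then have "Max_mset (adj_eigenvalues n G) \<in> set (diag_mat D)"
    using ms by (metis Max_in finite_set_mset set_mset_eq_empty_iff set_mset_mset)
  \<comment> \<open>One index carrying the largest eigenvalue is set aside. If that eigenvalue is
    repeated, its other copies stay among the nontrivial ones.\<close>
  then obtain k0 where k0: "k0 < n" "Max_mset (adj_eigenvalues n G) = ev k0"
    using len evd by (metis in_set_conv_nth)
  have small: "\<bar>ev k\<bar> \<le> lam" if "k < n" "k \<noteq> k0" for k
  proof -
    have "mset (diag_mat D) = image_mset ev (mset_set {..<n})"
    proof -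
      have "diag_mat D = map ev [0..<n]" using D(1) by (simp add: diag_mat_def ev_def)
      then show ?thesis by (simp only: mset_map mset_upt lessThan_atLeast0)
    qed
    also have "{..<n} = insert k0 (insert k ({..<n} - {k0, k}))" using k0 that by auto
    also have "image_mset ev (mset_set \<dots>) = {#ev k0#} + ({#ev k#} + image_mset ev (mset_set ({..<n} - {k0, k})))"
      using that by simp
    finally have "nontrivial_eigenvalues n G = {#ev k#} + image_mset ev (mset_set ({..<n} - {k0, k}))"
      unfolding nontrivial_eigenvalues_def k0(2) ms[symmetric] using ms by simp
    then show ?thesis using bound by simp
  qed
  have "(\<Sum>k<n. P $$ (i, k) * P $$ (j, k)) = (if i = j then 1 else 0)" if "i < n" "j < n" for i j
  proof -
    have "(P * P\<^sup>T) $$ (i, j) = (\<Sum>k<n. P $$ (i, k) * P $$ (j, k))"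
      using that P by (subst index_mult_mat_sum[OF P PT]) auto
    then show ?thesis using PP' that by simp
  qed
  moreover have "(\<Sum>k<n. ev k * (P $$ (i, k) * P $$ (j, k))) = (if G i j then 1 else 0)" if "i < n" "j < n" for i j
  proof -
    have pd: "(P * D) $$ (i, k) = P $$ (i, k) * ev k" if "k < n" for k
    proof -
      have "(P * D) $$ (i, k) = (\<Sum>l<n. P $$ (i, l) * D $$ (l, k))"
        by (rule index_mult_mat_sum[OF P D(1) \<open>i < n\<close> that])
      also have "\<dots> = (\<Sum>l<n. if l = k then P $$ (i, k) * ev k else 0)"
        using D that by (intro sum.cong refl) (auto simp: diagonal_mat_def ev_def)
      finally show ?thesis using that by simp
    qed
    have "(P * D * P\<^sup>T) $$ (i, j) = (\<Sum>k<n. (P * D) $$ (i, k) * P $$ (j, k))"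
      using that P by (subst index_mult_mat_sum[OF PD PT]) auto
    then show ?thesis unfolding \<open>P * D * P\<^sup>T = A\<close> using that
      by (simp add: pd A_def adj_matrix_def mult_ac del: index_mult_mat)
  qed
  ultimately show ?thesis using small k0(1)
    by (intro exI[of _ "\<lambda>i k. P $$ (i, k)"] exI[of _ ev] exI[of _ k0]) blast
qed

section \<open>From eigenvalues and degrees to the mixing estimate\<close>

lemma average_degree_bounds:
  assumes "n > 0" "i < n"
  shows "\<bar>real (degree_of n G i) - avg_degree n G\<bar> \<le> real (max_degree n G) - real (min_degree n G)"
proof -
  let ?D = "degree_of n G ` {..<n}"
  have b: "min_degree n G \<le> degree_of n G j \<and> degree_of n G j \<le> max_degree n G" if "j < n" for j
    using that by (simp add: min_degree_def max_degree_def)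
  have "(\<Sum>j<n. real (min_degree n G)) \<le> (\<Sum>j<n. real (degree_of n G j))"
    "(\<Sum>j<n. real (degree_of n G j)) \<le> (\<Sum>j<n. real (max_degree n G))"
    by (rule sum_mono, simp add: b)+
  then have "real (min_degree n G) \<le> avg_degree n G" "avg_degree n G \<le> real (max_degree n G)"
    using assms(1) by (simp_all add: avg_degree_def field_simps)
  then show ?thesis using b[OF assms(2)] by (simp add: abs_le_iff)
qed

lemma abs_sum_mult_le_L2_set:
  fixes f g :: "'a \<Rightarrow> real"
  shows "\<bar>\<Sum>i\<in>A. f i * g i\<bar> \<le> L2_set f A * L2_set g A"
proof -
  have "\<bar>\<Sum>i\<in>A. f i * g i\<bar> \<le> (\<Sum>i\<in>A. \<bar>f i\<bar> * \<bar>g i\<bar>)"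
    using sum_abs[of "\<lambda>i. f i * g i" A] by (simp add: abs_mult)
  then show ?thesis using L2_set_mult_ineq[of f g A] by linarith
qed

text \<open>Split test vectors into their mean and the part orthogonal to the all-ones vector \<open>\<one>\<close>.  The top
  eigenvector is nearly parallel to \<open>\<one>\<close>, since \<open>\<one>\<close> is nearly an eigenvector for the eigenvalue \<open>d\<close>.\<close>
lemma spectral_mixing_bilinear:
  fixes f g :: "nat \<Rightarrow> real"
  assumes G: "simple_graph_on n G" and n: "n > 0"
    and bound: "\<forall>x \<in># nontrivial_eigenvalues n G. \<bar>x\<bar> \<le> lam"
    and lam: "lam > 0" and R: "R > 0"
    and d: "d = avg_degree n G" "2 * lam \<le> d"
    and deg: "\<And>i. i < n \<Longrightarrow> \<bar>real (degree_of n G i) - d\<bar> \<le> R * lam"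
  shows "\<bar>(\<Sum>i<n. \<Sum>j<n. f i * (if G i j then 1 else 0) * g j) - d * (\<Sum>i<n. f i) * (\<Sum>i<n. g i) / n\<bar>
     \<le> (2 * R + 1 + (R + 1)\<^sup>2) * lam * (L2_set f {..<n} * L2_set g {..<n})"
proof -
  obtain P ev k0 where *: "k0 < n \<and>
      (\<forall>i<n. \<forall>j<n. (\<Sum>k<n. P i k * P j k) = (if i = j then 1 else 0)) \<and>
      (\<forall>i<n. \<forall>j<n. (\<Sum>k<n. ev k * (P i k * P j k)) = (if G i j then 1 else (0::real))) \<and>
      (\<forall>k<n. k \<noteq> k0 \<longrightarrow> \<bar>ev k\<bar> \<le> lam)"
    using adjacency_spectral_decomposition[OF G n bound] by (elim exE) (rule that)
  have k0: "k0 < n"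
    and P1: "\<And>i j. i < n \<Longrightarrow> j < n \<Longrightarrow> (\<Sum>k<n. P i k * P j k) = (if i = j then 1 else 0)"
    and P2: "\<And>i j. i < n \<Longrightarrow> j < n \<Longrightarrow> (\<Sum>k<n. ev k * (P i k * P j k)) = (if G i j then 1 else 0)"
    and ev: "\<And>k. k < n \<Longrightarrow> k \<noteq> k0 \<Longrightarrow> \<bar>ev k\<bar> \<le> lam"
    using * by simp_all
  define a :: "nat \<Rightarrow> nat \<Rightarrow> real" where "a i j = (if G i j then 1 else 0)" for i j
  define Q where "Q f g = (\<Sum>i<n. \<Sum>j<n. f i * a i j * g j)" for f g
  define N where "N f = L2_set f {..<n}" for f
  define h where "h f k = (\<Sum>i<n. f i * P i k)" for f k
  have N0: "N f \<ge> 0" for f by (simp add: N_def)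
  have N2: "(N f)\<^sup>2 = (\<Sum>i<n. (f i)\<^sup>2)" for f by (simp add: N_def L2_set_def sum_nonneg)
  \<comment> \<open>One identity for two uses: with \<open>c = ev\<close> it expands the bilinear
    form in eigenvectors, with \<open>c\<close> constantly 1 it is Parseval's identity.\<close>
  have sum3: "(\<Sum>k<n. c k * (h f k * h g k)) = (\<Sum>i<n. \<Sum>j<n. f i * (\<Sum>k<n. c k * (P i k * P j k)) * g j)"
    for c :: "nat \<Rightarrow> real" and f g
  proof -
    have "(\<Sum>k<n. c k * (h f k * h g k)) = (\<Sum>k<n. \<Sum>i<n. \<Sum>j<n. f i * (c k * (P i k * P j k)) * g j)"
      unfolding h_def unfolding sum_product unfolding sum_distrib_left by (intro sum.cong refl) (simp add: mult_ac)
    also have "\<dots> = (\<Sum>i<n. \<Sum>k<n. \<Sum>j<n. f i * (c k * (P i k * P j k)) * g j)" by (rule sum.swap)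
    also have "\<dots> = (\<Sum>i<n. \<Sum>j<n. \<Sum>k<n. f i * (c k * (P i k * P j k)) * g j)"
      by (rule sum.cong[OF refl]) (rule sum.swap)
    finally show ?thesis by (simp only: sum_distrib_left sum_distrib_right)
  qed
  have Qh: "Q f g = (\<Sum>k<n. ev k * (h f k * h g k))" for f g
    unfolding sum3 Q_def by (intro sum.cong refl) (simp add: P2 a_def)
  have Nh: "L2_set (h f) {..<n} = N f" for f
  proof -
    have "(\<Sum>k<n. 1 * (h f k * h f k)) = (\<Sum>i<n. \<Sum>j<n. f i * (if i = j then 1 else 0) * f j)"
      unfolding sum3 by (intro sum.cong refl) (simp add: P1)
    also have "\<dots> = (\<Sum>i<n. \<Sum>j<n. if j = i then (f i)\<^sup>2 else 0)"
      by (intro sum.cong refl) (simp add: power2_eq_square)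
    also have "\<dots> = (\<Sum>i<n. (f i)\<^sup>2)" by simp
    finally show ?thesis by (simp add: L2_set_def N_def power2_eq_square)
  qed
  have Q1: "\<bar>Q f g - ev k0 * h f k0 * h g k0\<bar> \<le> lam * (N f * N g)" for f g
  proof -
    have "Q f g - ev k0 * h f k0 * h g k0 = (\<Sum>k\<in>{..<n} - {k0}. ev k * (h f k * h g k))"
      unfolding Qh using k0 by (simp add: sum_diff1)
    then have "\<bar>Q f g - ev k0 * h f k0 * h g k0\<bar> \<le> (\<Sum>k\<in>{..<n} - {k0}. \<bar>ev k * (h f k * h g k)\<bar>)"
      by (simp add: sum_abs)
    also have "\<dots> \<le> (\<Sum>k\<in>{..<n} - {k0}. lam * (\<bar>h f k\<bar> * \<bar>h g k\<bar>))"
      using ev by (intro sum_mono) (auto simp: abs_mult intro!: mult_right_mono)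
    also have "\<dots> \<le> (\<Sum>k<n. lam * (\<bar>h f k\<bar> * \<bar>h g k\<bar>))"
      using lam by (intro sum_mono2) auto
    also have "\<dots> = lam * (\<Sum>k<n. \<bar>h f k\<bar> * \<bar>h g k\<bar>)" by (simp add: sum_distrib_left)
    also have "\<dots> \<le> lam * (N f * N g)"
      using L2_set_mult_ineq[of "h f" "h g" "{..<n}"] lam unfolding Nh by (intro mult_left_mono) auto
    finally show ?thesis .
  qed
  have Qsym: "Q f g = Q g f" for f g
    unfolding Qh by (intro sum.cong refl) (simp add: mult_ac)
  have rowsum: "(\<Sum>j<n. a i j) = degree_of n G i" for i
  proof -
    have "{..<n} \<inter> {j. G i j} = {j. j < n \<and> G i j}" by auto
    then show ?thesis by (simp add: a_def degree_of_def sum.If_cases)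
  qed
  define one :: "nat \<Rightarrow> real" where "one = (\<lambda>_. 1)"
  have Qone: "Q f one = (\<Sum>i<n. f i * degree_of n G i)" for f
    unfolding Q_def one_def rowsum[symmetric] by (simp add: sum_distrib_left)
  have None: "N one = sqrt n" by (simp add: N_def one_def L2_set_def)
  define m where "m f = (\<Sum>i<n. f i) / n" for f :: "nat \<Rightarrow> real"
  define r where "r f i = f i - m f" for f :: "nat \<Rightarrow> real" and i
  have sumr: "(\<Sum>i<n. r f i) = 0" for f using n by (simp add: r_def m_def sum_subtractf)
  have Nr: "(N f)\<^sup>2 = (N (r f))\<^sup>2 + n * (m f)\<^sup>2" for f
  proof -
    have "(N f)\<^sup>2 = (\<Sum>i<n. (r f i)\<^sup>2 + 2 * m f * r f i + (m f)\<^sup>2)"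
      unfolding N2 by (intro sum.cong refl) (simp add: r_def power2_eq_square algebra_simps)
    also have "\<dots> = (N (r f))\<^sup>2 + 2 * m f * (\<Sum>i<n. r f i) + n * (m f)\<^sup>2"
      by (simp add: sum.distrib N2 sum_distrib_left)
    finally show ?thesis by (simp add: sumr)
  qed
  have Nrle: "N (r f) \<le> N f" for f
    by (rule power2_le_imp_le) (use Nr[of f] N0 in auto)
  have mle: "\<bar>m f\<bar> * sqrt n \<le> N f" for f
    by (rule power2_le_imp_le) (use Nr[of f] N0 in \<open>auto simp: power_mult_distrib mult.commute\<close>)
  have Qr1: "\<bar>Q (r f) one\<bar> \<le> R * lam * sqrt n * N f" for f
  proof -
    \<comment> \<open>As \<open>r f\<close> sums to 0, the constant \<open>d\<close> may be
      subtracted from every degree at no cost.\<close>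
    have "Q (r f) one = (\<Sum>i<n. r f i * (degree_of n G i - d)) + d * (\<Sum>i<n. r f i)"
      unfolding Qone by (simp add: algebra_simps sum_subtractf sum_distrib_left)
    then have "\<bar>Q (r f) one\<bar> \<le> N (r f) * L2_set (\<lambda>i. degree_of n G i - d) {..<n}"
      using abs_sum_mult_le_L2_set[of "r f" "\<lambda>i. degree_of n G i - d" "{..<n}"]
      by (simp add: sumr N_def)
    moreover have "L2_set (\<lambda>i. degree_of n G i - d) {..<n} \<le> R * lam * sqrt n"
    proof -
      have "(\<Sum>i<n. (real (degree_of n G i) - d)\<^sup>2) \<le> (\<Sum>i<n. (R * lam)\<^sup>2)"
        using deg R lam by (intro sum_mono) (auto simp: abs_le_square_iff[symmetric])
      then have "sqrt (\<Sum>i<n. (real (degree_of n G i) - d)\<^sup>2) \<le> sqrt (n * (R * lam)\<^sup>2)" by simp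
      also have "\<dots> = R * lam * sqrt n" using R lam by (simp add: real_sqrt_mult)
      finally show ?thesis by (simp add: L2_set_def)
    qed
    then have "N (r f) * L2_set (\<lambda>i. degree_of n G i - d) {..<n} \<le> N f * (R * lam * sqrt n)"
      using Nrle[of f] N0 by (intro mult_mono) auto
    ultimately show ?thesis by (simp add: mult_ac)
  qed
  define e where "e = ev k0"
  define p where "p f = h f k0" for f
  have Q1': "\<bar>Q f g - e * p f * p g\<bar> \<le> lam * (N f * N g)" for f g using Q1 by (simp add: e_def p_def)
  have deg_sum: "Q one one = n * d"
    unfolding Qone d(1) avg_degree_def using n by (simp add: one_def)
  \<comment> \<open>The form at the all-ones vector is exactly \<open>n * d\<close>, and the other
    eigenvalues contribute at most \<open>lam * n\<close>, no more than half of it.\<close>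
  have top: "n * d / 2 \<le> e * (p one)\<^sup>2"
  proof -
    have "\<bar>n * d - e * (p one)\<^sup>2\<bar> \<le> lam * n"
      using Q1'[of one one] by (simp add: deg_sum None power2_eq_square mult.assoc)
    moreover have "lam * n \<le> n * d / 2" using d(2) n by simp
    ultimately show ?thesis by linarith
  qed
  have er: "\<bar>e * p (r f) * p one\<bar> \<le> (R + 1) * lam * sqrt n * N f" for f
  proof -
    have "lam * (N (r f) * N one) \<le> lam * (N f * sqrt n)"
      using Nrle lam n by (simp add: None)
    then show ?thesis using Q1'[of "r f" one] Qr1[of f] by (simp add: algebra_simps)
  qed
  \<comment> \<open>Multiplying by \<open>e * (p one)\<^sup>2\<close>, which is at least
    \<open>n * d / 2\<close>, turns the term into a product of two mixed terms bounded by
    \<open>er\<close>; then \<open>n * d / 2\<close> is cancelled.\<close>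
  have err: "\<bar>e * p (r f) * p (r g)\<bar> \<le> (R + 1)\<^sup>2 * lam * (N f * N g)"
  proof -
    let ?x = "\<bar>e * p (r f) * p (r g)\<bar>"
    have "?x * (n * d / 2) \<le> ?x * (e * (p one)\<^sup>2)" using top by (intro mult_left_mono) auto
    also have "\<dots> \<le> ?x * \<bar>e * (p one)\<^sup>2\<bar>" by (intro mult_left_mono) auto
    also have "\<dots> = \<bar>e * p (r f) * p one\<bar> * \<bar>e * p (r g) * p one\<bar>"
      by (simp add: abs_mult power2_eq_square mult_ac)
    also have "\<dots> \<le> ((R + 1) * lam * sqrt n * N f) * ((R + 1) * lam * sqrt n * N g)"
      using er N0 R lam by (intro mult_mono) auto
    also have "\<dots> = n * lam * ((R + 1)\<^sup>2 * lam * (N f * N g))"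
      by (simp add: power2_eq_square)
    also have "\<dots> \<le> n * (d / 2) * ((R + 1)\<^sup>2 * lam * (N f * N g))"
      using d(2) N0 R lam by (intro mult_right_mono mult_left_mono) auto
    finally have "(n * d / 2) * ?x \<le> (n * d / 2) * ((R + 1)\<^sup>2 * lam * (N f * N g))" by (simp add: mult_ac)
    moreover have "n * d / 2 > 0" using n d(2) lam by simp
    ultimately show ?thesis by (simp only: mult_le_cancel_left_pos)
  qed
  have Qrr: "\<bar>Q (r f) (r g)\<bar> \<le> (1 + (R + 1)\<^sup>2) * lam * (N f * N g)"
  proof -
    have "lam * (N (r f) * N (r g)) \<le> lam * (N f * N g)"
      using Nrle N0 lam by (intro mult_left_mono mult_mono) auto
    then show ?thesis using Q1'[of "r f" "r g"] err by (simp add: algebra_simps)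
  qed
  have add: "Q (\<lambda>i. x i + c * y i) g = Q x g + c * Q y g" for x y g and c :: real
    by (simp add: Q_def sum.distrib sum_distrib_left algebra_simps)
  have split: "Q x y = Q (r x) y + m x * Q one y" for x y
    using add[of "r x" "m x" one y] by (simp add: r_def one_def)
  have "Q f g = Q (r f) g + m f * Q one g" by (rule split)
  also have "Q (r f) g = Q (r f) (r g) + m g * Q (r f) one"
    using split[of g "r f"] by (simp only: Qsym[of _ "r f"])
  also have "Q one g = Q (r g) one + m g * Q one one"
    using split[of g one] by (simp only: Qsym[of one g])
  finally have "Q f g = Q (r f) (r g) + m g * Q (r f) one + m f * (Q (r g) one + m g * Q one one)" .
  moreover have "d * (\<Sum>i<n. f i) * (\<Sum>i<n. g i) / n = m f * m g * Q one one"
    unfolding deg_sum m_def using n by simp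
  ultimately have eq: "Q f g - d * (\<Sum>i<n. f i) * (\<Sum>i<n. g i) / n
      = Q (r f) (r g) + m g * Q (r f) one + m f * Q (r g) one"
    by (simp add: algebra_simps)
  have cross: "\<bar>m x * Q (r y) one\<bar> \<le> R * lam * (N x * N y)" for x y
  proof -
    have "\<bar>m x * Q (r y) one\<bar> \<le> \<bar>m x\<bar> * (R * lam * sqrt n * N y)"
      using Qr1[of y] by (simp add: abs_mult mult_left_mono)
    also have "\<dots> = (\<bar>m x\<bar> * sqrt n) * (R * lam * N y)" by simp
    also have "\<dots> \<le> N x * (R * lam * N y)"
      using mle[of x] N0 R lam by (intro mult_right_mono) auto
    finally show ?thesis by (simp add: mult_ac)
  qed
  have "\<bar>Q f g - d * (\<Sum>i<n. f i) * (\<Sum>i<n. g i) / n\<bar> \<le> (2 * R + 1 + (R + 1)\<^sup>2) * lam * (N f * N g)"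
    unfolding eq using Qrr cross[of g f] cross[of f g] by (simp add: algebra_simps)
  then show ?thesis by (simp add: Q_def a_def N_def)
qed

text \<open>The bilinear estimate is applied to indicator vectors, whose norms are square roots of
  cardinalities. The degree gap \<open>R * lam\<close> is at most half the average degree, which
  gives the minimum degree.\<close>

lemma pseudorandom_of_spectrum:
  assumes G: "simple_graph_on n G" and n: "n > 0"
    and bound: "\<forall>x \<in># nontrivial_eigenvalues n G. \<bar>x\<bar> \<le> lam"
    and lam: "lam > 0" and R: "R > 0"
    and deg: "real (max_degree n G) - real (min_degree n G) \<le> R * lam"
    and d: "2 * lam \<le> avg_degree n G" "2 * R * lam \<le> avg_degree n G"
  shows "pseudorandom n G (avg_degree n G) ((2 * R + 1 + (R + 1)\<^sup>2) * lam)"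
proof
  let ?d = "avg_degree n G"
  have deg': "\<bar>real (degree_of n G i) - ?d\<bar> \<le> R * lam" if "i < n" for i
    using average_degree_bounds[OF n that, of G] deg by linarith
  show "simple_graph_on n G" "0 < n" by fact+
  show "0 < ?d" using d lam by linarith
  have "0 < 2 * R + 1 + (R + 1)\<^sup>2" using R by (simp add: add_pos_nonneg)
  then show "0 < (2 * R + 1 + (R + 1)\<^sup>2) * lam" using lam by simp
  show "?d / 2 \<le> card {w \<in> {..<n}. G v w}" if "v < n" for v
    using deg'[OF that] d(2) by (simp add: degree_of_def)
  fix X Y assume XY: "X \<subseteq> {..<n}" "Y \<subseteq> {..<n}"
  have s: "(\<Sum>i<n. indicator X i * F i) = (\<Sum>i\<in>X. F i)" if "X \<subseteq> {..<n}" for X and F :: "nat \<Rightarrow> real"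
    using that by (simp add: indicator_def if_distrib[of "\<lambda>x. x * _"] sum.inter_restrict[symmetric] Int_absorb1 cong: if_cong)
  have sc: "(\<Sum>i<n. indicator X i) = real (card X)" if "X \<subseteq> {..<n}" for X
    using s[OF that, of "\<lambda>_. 1"] by simp
  have N: "L2_set (indicator X) {..<n} = sqrt (card X)" if "X \<subseteq> {..<n}" for X
  proof -
    have "(indicator X i)\<^sup>2 = (indicator X i :: real)" for i by (simp add: indicator_def)
    then show ?thesis using sc[OF that] by (simp add: L2_set_def)
  qed
  have "(\<Sum>i<n. \<Sum>j<n. indicator X i * (if G i j then 1 else 0) * indicator Y j) = edge_count G X Y"
  proof -
    have "(\<Sum>i<n. \<Sum>j<n. indicator X i * (if G i j then 1 else 0) * indicator Y j)
       = (\<Sum>i<n. indicator X i * (\<Sum>j<n. indicator Y j * (if G i j then 1 else (0::real))))"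
      unfolding sum_distrib_left by (intro sum.cong refl) (simp only: mult_ac)
    also have "\<dots> = (\<Sum>i\<in>X. \<Sum>j\<in>Y. if G i j then 1 else 0)"
      by (simp only: s[OF XY(1)] s[OF XY(2)])
    also have "\<dots> = edge_count G X Y"
      unfolding edge_count_def using finite_subset[OF XY(2)]
      by (intro sum.cong refl) (simp add: sum.If_cases Int_def)
    finally show ?thesis .
  qed
  then show "\<bar>edge_count G X Y - ?d * card X * card Y / n\<bar>
      \<le> (2 * R + 1 + (R + 1)\<^sup>2) * lam * sqrt (card X * card Y)"
    using spectral_mixing_bilinear[OF G n bound lam R refl d(1) deg', of "indicator X" "indicator Y"]
    by (simp add: sc[OF XY(1)] sc[OF XY(2)] N[OF XY(1)] N[OF XY(2)] real_sqrt_mult)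
qed

text \<open>This lets \<open>\<mu>\<close> absorb additive constants. For large \<open>d\<close> the
  missing loop at vertex 0 is a deficit in mixing; otherwise the star from 0 to its neighbours is an
  excess.\<close>

lemma (in pseudorandom) mu_ge_half: "1 / 2 \<le> \<mu>"
proof (cases "d \<le> n / 2")
  case False
  have "edge_count G {0} {0} = 0" using graph by (simp add: edge_count_def simple_graph_on_def)
  then have "d / n \<le> \<mu>" using mixing[of "{0}" "{0}"] n_pos d_pos by simp
  moreover have "1 / 2 \<le> d / n" using False n_pos by (simp add: field_simps)
  ultimately show ?thesis by linarith
next
  case True
  define N where "N = {w \<in> {..<n}. G 0 w}"
  define s where "s = sqrt (card N)"
  have "real (card N) > 0" using min_deg[of 0] n_pos d_pos by (simp add: N_def)
  then have "card N \<ge> 1" by linarith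
  then have s1: "s \<ge> 1" by (simp add: s_def)
  have s2: "s * s = card N" by (simp add: s_def)
  have "{y \<in> N. G 0 y} = N" by (auto simp: N_def)
  then have "edge_count G {0} N = card N" by (simp add: edge_count_def)
  moreover have "N \<subseteq> {..<n}" by (auto simp: N_def)
  ultimately have "card N - d * card N / n \<le> \<mu> * s"
    using mixing[of "{0}" N] n_pos by (simp add: s_def)
  moreover have "d * card N / n \<le> card N / 2"
    using mult_right_mono[OF True, of "card N"] n_pos by (simp add: field_simps)
  ultimately have "s * s / 2 \<le> \<mu> * s" using s2 by linarith
  then have "s / 2 \<le> \<mu>" using s1 by simp
  then show ?thesis using s1 by linarith
qed

section \<open>Asymptotics\<close>

lemma prod_linear: "(\<Prod>j=1..n. c * real j) = c ^ n * fact n"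
  by (simp add: prod.distrib fact_prod)

lemma prod_split_at:
  fixes f :: "nat \<Rightarrow> real"
  assumes "k \<le> n" shows "(\<Prod>j=1..n. f j) = (\<Prod>j=1..k. f j) * (\<Prod>j=k+1..n. f j)"
proof -
  have "{1..n} = {1..k} \<union> {k+1..n}" using assms by auto
  then show ?thesis by (simp add: prod.union_disjoint)
qed

text \<open>For \<open>j \<ge> k\<close> the error is a fraction of \<open>d * j / n\<close> of
  order \<open>1 / q\<close>, so each factor of the products changes by at most
  \<open>1 - 3 / q\<close> or \<open>1 + 3 / q\<close>. The first \<open>k\<close> factors are
  estimated trivially, which costs a further power of \<open>n + 1\<close>.\<close>

lemma (in pseudorandom) hamilton_cycle_count_bounds:
  assumes "s = 2 * \<rho> + 3" "n \<le> 2 ^ \<rho>" "16 * s \<le> n" "100 * \<mu> * s \<le> d"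
    and k: "k \<le> n" "q * \<mu> \<le> d * k / n" "q \<ge> 3" and d: "d \<le> n"
  defines "E \<equiv> 2 * k + (k + 1) * (4 * \<rho> + 6) + 2"
  shows "fact n * (d / n) ^ n * (1 - 3 / q) ^ n \<le> real (n + 1) ^ E * num_hamilton_cycles n G"
    and "num_hamilton_cycles n G \<le> fact n * (d / n) ^ n * (1 + 3 / q) ^ n * real (n + 1) ^ E"
proof -
  define H where "H = real (num_hamilton_cycles n G)"
  define c where "c = d / n"
  have c: "0 < c" "c \<le> 1" using d_pos n_pos d by (auto simp: c_def)
  have delta: "0 \<le> 1 - 3 / q" "1 - 3 / q \<le> 1" "1 \<le> 1 + 3 / q" using k(3) by auto
  have "1 * \<mu> \<le> real s * \<mu>" using assms(1) mu_pos by (intro mult_right_mono) auto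
  moreover have "100 * (real s * \<mu>) \<le> d" using assms(4) by (simp add: mult_ac)
  ultimately have mud: "\<mu> \<le> d" using mu_pos by linarith
  \<comment> \<open>The multiple 3 is chosen because the lower bound loses \<open>\<mu> + 1\<close>,
    which is at most \<open>3 * \<mu>\<close>.\<close>
  have large: "3 * \<mu> \<le> 3 / q * (c * j)" if "j \<ge> k" for j
  proof -
    have "q * \<mu> \<le> c * k" using k(2) by (simp add: c_def)
    also have "\<dots> \<le> c * j" using that c by simp
    finally show ?thesis using k(3) by (simp add: field_simps)
  qed
  have "3 * \<mu> \<le> q * \<mu>" using k(3) mu_pos by simp
  then have mu1: "\<mu> + 1 \<le> 3 * \<mu>" "\<mu> + 1 \<le> d * k / n" using mu_ge_half k(2) by linarith+
  have B: "(\<Prod>j=1..k. c * real j) \<le> real (n + 1) ^ k"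
  proof -
    have "(\<Prod>j=1..k. c * real j) \<le> (\<Prod>j=1..k. real (n + 1))"
    proof (rule prod_mono)
      fix j assume "j \<in> {1..k}"
      then have j: "j \<le> n" using k(1) by simp
      have "c * real j \<le> 1 * real j" by (rule mult_right_mono[OF c(2)]) simp
      also have "\<dots> \<le> real (n + 1)" using j by simp
      finally show "0 \<le> c * real j \<and> c * real j \<le> real (n + 1)" using c by simp
    qed
    then show ?thesis by simp
  qed
  have split: "c ^ n * fact n = (\<Prod>j=1..k. c * real j) * (\<Prod>j=k+1..n. c * real j)"
    unfolding prod_linear[symmetric] by (rule prod_split_at[OF k(1)])
  have pos: "0 \<le> (\<Prod>j=k+1..n. c * real j)" using c by (intro prod_nonneg) auto
  have E: "E = k + (k + (k + 1) * (4 * \<rho> + 6) + 2)" by (simp add: E_def)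

  have "(\<Prod>j=k+1..n. c * real j) * (1 - 3 / q) ^ n \<le> (\<Prod>j=k+1..n. c * real j) * (1 - 3 / q) ^ (n - k)"
    using pos delta by (intro mult_left_mono power_decreasing) auto
  also have "\<dots> = (\<Prod>j=k+1..n. (1 - 3 / q) * (c * real j))" by (simp add: prod.distrib mult.commute)
  also have "\<dots> \<le> (\<Prod>j=k+1..n. d * real j / n - \<mu> - 1)"
  proof (rule prod_mono)
    fix j assume "j \<in> {k+1..n}"
    then have "3 * \<mu> \<le> 3 / q * (c * j)" by (intro large) auto
    moreover have "d * real j / n = c * j" by (simp add: c_def)
    moreover have "0 \<le> (1 - 3 / q) * (c * real j)" using delta c by (intro mult_nonneg_nonneg) auto
    ultimately show "0 \<le> (1 - 3 / q) * (c * real j) \<and> (1 - 3 / q) * (c * real j) \<le> d * real j / n - \<mu> - 1"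
      using mu1(1) by (simp add: left_diff_distrib)
  qed
  also have "\<dots> \<le> real (n + 1) ^ (k + (k + 1) * (4 * \<rho> + 6) + 2) * H"
    unfolding H_def by (rule lower_bound[OF assms(1-4) mu1(2) k(1)])
  finally have 1: "(\<Prod>j=k+1..n. c * real j) * (1 - 3 / q) ^ n \<le> real (n + 1) ^ (k + (k + 1) * (4 * \<rho> + 6) + 2) * H" .
  have "c ^ n * fact n * (1 - 3 / q) ^ n = (\<Prod>j=1..k. c * real j) * ((\<Prod>j=k+1..n. c * real j) * (1 - 3 / q) ^ n)"
    by (simp add: split)
  also have "\<dots> \<le> real (n + 1) ^ k * (real (n + 1) ^ (k + (k + 1) * (4 * \<rho> + 6) + 2) * H)"
    using pos delta by (intro mult_mono B 1) (auto intro!: mult_nonneg_nonneg)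
  also have "\<dots> = real (n + 1) ^ E * H" unfolding E power_add by simp
  finally show "fact n * (d / n) ^ n * (1 - 3 / q) ^ n \<le> real (n + 1) ^ E * num_hamilton_cycles n G"
    by (simp add: c_def H_def mult_ac)

  have "H \<le> (\<Prod>j=1..n. d * real j / n + \<mu>)" unfolding H_def by (rule upper_bound)
  also have "\<dots> = (\<Prod>j=1..k. d * real j / n + \<mu>) * (\<Prod>j=k+1..n. d * real j / n + \<mu>)"
    by (rule prod_split_at[OF k(1)])
  also have "\<dots> \<le> (\<Prod>j=1..k. real (n + 1) * (c * real j)) * (\<Prod>j=k+1..n. (1 + 3 / q) * (c * real j))"
  proof (intro mult_mono prod_mono)
    fix j assume "j \<in> {1..k}"
    \<comment> \<open>For small \<open>j\<close> the error may exceed \<open>d * j / n\<close>, but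
      \<open>\<mu> \<le> d\<close> keeps it below \<open>n\<close> times that.\<close>
    then have "d * 1 \<le> d * j" using d_pos by (intro mult_left_mono) auto
    then have "\<mu> \<le> d * j" using mud by linarith
    moreover have "real (n + 1) * (c * real j) = d * j / n + d * j" using n_pos by (simp add: c_def field_simps)
    ultimately show "0 \<le> d * real j / n + \<mu> \<and> d * real j / n + \<mu> \<le> real (n + 1) * (c * real j)"
      using mud mu_pos d_pos by auto
  next
    fix j assume "j \<in> {k+1..n}"
    then have "3 * \<mu> \<le> 3 / q * (c * j)" by (intro large) auto
    moreover have "d * real j / n = c * j" by (simp add: c_def)
    ultimately show "0 \<le> d * real j / n + \<mu> \<and> d * real j / n + \<mu> \<le> (1 + 3 / q) * (c * real j)"
      using mu_pos c by (simp add: distrib_right)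
  qed (use c mu_pos d_pos in \<open>auto intro!: prod_nonneg add_nonneg_nonneg mult_nonneg_nonneg\<close>)
  also have "\<dots> = c ^ n * fact n * (real (n + 1) ^ k * (1 + 3 / q) ^ (n - k))"
    unfolding split by (simp add: prod.distrib mult_ac)
  also have "\<dots> \<le> c ^ n * fact n * (real (n + 1) ^ E * (1 + 3 / q) ^ n)"
  proof (intro mult_left_mono mult_mono)
    show "real (n + 1) ^ k \<le> real (n + 1) ^ E" by (rule power_increasing) (auto simp: E_def)
    show "(1 + 3 / q) ^ (n - k) \<le> (1 + 3 / q) ^ n" by (rule power_increasing) (use delta in auto)
  qed (use c delta in auto)
  finally show "num_hamilton_cycles n G \<le> fact n * (d / n) ^ n * (1 + 3 / q) ^ n * real (n + 1) ^ E"
    by (simp add: c_def H_def mult_ac)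
qed

lemma exists_log2_bound:
  fixes n :: nat
  assumes "n \<ge> 3"
  shows "\<exists>\<rho>. n \<le> 2 ^ \<rho> \<and> real \<rho> \<le> 3 * ln n"
proof -
  define \<rho> where "\<rho> = nat \<lceil>log 2 n\<rceil>"
  have l: "log 2 n \<ge> 0" using assms by simp
  have "real n = 2 powr (log 2 n)" using assms by simp
  also have "\<dots> \<le> 2 powr real \<rho>" unfolding \<rho>_def using l by (intro powr_mono) linarith+
  also have "\<dots> = 2 ^ \<rho>" by (simp add: powr_realpow)
  finally have "real n \<le> real (2 ^ \<rho>)" by simp
  then have "n \<le> 2 ^ \<rho>" by (simp only: of_nat_le_iff)
  have "exp 1 \<le> (3 :: real)" by (rule exp_le)
  then have ln1: "1 \<le> ln n" using assms by (subst ln_ge_iff) auto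
  have "ln 2 \<ge> (1 / 2 :: real)" using ln2_ge_two_thirds by linarith
  then have "log 2 n \<le> 2 * ln n" using ln1 unfolding log_def
    by (subst pos_divide_le_eq) (auto intro: order.trans[OF _ mult_left_mono[of "1/2" "ln 2" "2 * ln n"]])
  then have "real \<rho> \<le> 2 * ln n + 1" unfolding \<rho>_def using l by linarith
  then show ?thesis using \<open>n \<le> 2 ^ \<rho>\<close> ln1 by (intro exI[of _ \<rho>]) linarith
qed

text \<open>The choice of \<open>k\<close>: the error factor \<open>n ^ (k log n)\<close> is subexponential while \<open>d k / n\<close> still dominates \<open>\<mu>\<close>.\<close>
lemma (in pseudorandom) hamilton_cycle_count_exp:
  assumes n: "n \<ge> 3" "real n \<ge> 200 * ln n" and d: "d \<le> n"
    and q: "q \<ge> 1000" "d = q\<^sup>2 * (\<mu> * (ln n)\<^sup>2)"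
  defines "t \<equiv> 200 * (1 / q + (ln n)\<^sup>2 / n)"
  shows "fact n * (d / n) ^ n * ((1 - 3 / q) * exp (- t)) ^ n \<le> num_hamilton_cycles n G"
    and "num_hamilton_cycles n G \<le> fact n * (d / n) ^ n * ((1 + 3 / q) * exp t) ^ n"
proof -
  define L where "L = ln (real n)"
  have "exp 1 \<le> (3 :: real)" by (rule exp_le)
  then have L1: "1 \<le> L" unfolding L_def using n by (subst ln_ge_iff) auto
  obtain \<rho> where rho: "n \<le> 2 ^ \<rho>" "real \<rho> \<le> 3 * L" using exists_log2_bound[OF n(1)] by (auto simp: L_def)
  \<comment> \<open>This is at most \<open>9 * ln n\<close>, so \<open>16 * s\<close> is within the
    assumed \<open>200 * ln n \<le> n\<close>.\<close>
  define s where "s = 2 * \<rho> + 3"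
  have sL: "real s \<le> 9 * L" using rho L1 by (simp add: s_def)
  have "real (16 * s) \<le> real n" using sL n(2) L1 by (simp add: L_def)
  then have ns: "16 * s \<le> n" by (simp only: of_nat_le_iff)
  have qmu: "0 \<le> q * \<mu>" using q(1) mu_pos by simp
  have L2: "L \<le> L\<^sup>2" using L1 by (simp add: power2_eq_square)
  have ds: "100 * \<mu> * s \<le> d"
  proof -
    have "100 * \<mu> * s \<le> 100 * \<mu> * (9 * L)" using sL mu_pos by (intro mult_left_mono) auto
    also have "\<dots> \<le> 100 * \<mu> * (9 * L\<^sup>2)" using L2 mu_pos by (intro mult_left_mono) auto
    also have "\<dots> = 900 * (\<mu> * L\<^sup>2)" by simp
    also have "\<dots> \<le> q\<^sup>2 * (\<mu> * L\<^sup>2)"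
    proof (rule mult_right_mono)
      have "1000 * 1000 \<le> q * q" using q(1) by (intro mult_mono) auto
      then show "900 \<le> q\<^sup>2" by (simp add: power2_eq_square)
    qed (use mu_pos in simp)
    finally show ?thesis using q(2) by (simp add: L_def)
  qed
  \<comment> \<open>Of the factor \<open>q\<^sup>2\<close> in \<open>d\<close>, one \<open>q\<close>
    is spent on making \<open>k\<close> small and the other remains in
    \<open>q * \<mu> \<le> d * k / n\<close>.\<close>
  define k where "k = nat \<lceil>n / (q * L\<^sup>2)\<rceil>"
  have qL: "1 \<le> q * L\<^sup>2" using mult_mono[of 1 q 1 "L\<^sup>2"] q(1) L1 by auto
  have "0 \<le> n / (q * L\<^sup>2)" using qL by (intro divide_nonneg_nonneg) auto
  then have k1: "n / (q * L\<^sup>2) \<le> k" "k \<le> n / (q * L\<^sup>2) + 1" unfolding k_def by linarith+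
  have "n / (q * L\<^sup>2) \<le> n" using qL n_pos by (simp add: field_simps)
  then have kn: "k \<le> n" unfolding k_def by linarith
  have kq: "q * \<mu> \<le> d * k / n"
  proof -
    have "q * \<mu> = d * (n / (q * L\<^sup>2)) / n" using q n_pos L1 by (simp add: L_def[symmetric] field_simps power2_eq_square)
    also have "\<dots> \<le> d * k / n" using k1(1) d_pos by (intro divide_right_mono mult_left_mono) auto
    finally show ?thesis .
  qed
  define E where "E = 2 * k + (k + 1) * (4 * \<rho> + 6) + 2"
  \<comment> \<open>Here \<open>E\<close> equals \<open>(k + 1) * (4 * \<rho> + 8)\<close>, so its
    product with \<open>ln (n + 1)\<close> is at most
    \<open>40 * n / q + 80 * (ln n)\<^sup>2\<close>, which the constant 200 in \<open>t\<close>
    covers.\<close>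
  have tE: "real (n + 1) ^ E \<le> exp t ^ n"
  proof -
    have "real E \<le> real ((k + 1) * (4 * \<rho> + 8))" unfolding E_def by (simp only: of_nat_le_iff) (simp add: algebra_simps)
    also have "\<dots> = (real k + 1) * (4 * real \<rho> + 8)" by (simp add: algebra_simps)
    also have "\<dots> \<le> (n / (q * L\<^sup>2) + 2) * (20 * L)"
      using k1 rho L1 qL by (intro mult_mono) auto
    finally have EL: "real E \<le> (n / (q * L\<^sup>2) + 2) * (20 * L)" .
    have "3 * n \<le> n * n" by (rule mult_le_mono1[OF n(1)])
    then have "n + 1 \<le> n * n" using n(1) by linarith
    then have "real (n + 1) \<le> real (n * n)" by (simp only: of_nat_le_iff)
    then have "real (n + 1) \<le> real n * real n" by simp
    then have "ln (real (n + 1)) \<le> ln (real n * real n)" using n(1) by (subst ln_le_cancel_iff) auto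
    also have "\<dots> = 2 * L" using n(1) by (simp add: L_def ln_mult)
    finally have lnL: "ln (real (n + 1)) \<le> 2 * L" .
    have "E * ln (real (n + 1)) \<le> ((n / (q * L\<^sup>2) + 2) * (20 * L)) * (2 * L)"
      using EL lnL L1 qL n(1) by (intro mult_mono) auto
    also have "\<dots> = 40 * (n / q) + 80 * L\<^sup>2" using L1 q(1) by (simp add: field_simps power2_eq_square)
    also have "\<dots> \<le> n * t"
      using n_pos q(1) by (simp add: t_def L_def field_simps)
    finally have "exp (E * ln (real (n + 1))) \<le> exp (n * t)" by simp
    moreover have "exp (E * ln (real (n + 1))) = real (n + 1) ^ E"
      by (simp add: exp_of_nat_mult)
    ultimately have "real (n + 1) ^ E \<le> exp (real n * t)" by linarith
    then show ?thesis by (simp only: exp_of_nat_mult)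
  qed
  have q3: "q \<ge> 3" using q(1) by simp
  note b = hamilton_cycle_count_bounds[OF s_def rho(1) ns ds kn kq q3 d, folded E_def]
  let ?H = "real (num_hamilton_cycles n G)"
  have "fact n * (d / n) ^ n * (1 - 3 / q) ^ n \<le> exp t ^ n * ?H"
    using b(1) mult_right_mono[OF tE, of ?H] by linarith
  then have "fact n * (d / n) ^ n * (1 - 3 / q) ^ n * exp (- t) ^ n \<le> exp t ^ n * ?H * exp (- t) ^ n"
    by (rule mult_right_mono) simp
  also have "exp t ^ n * ?H * exp (- t) ^ n = ?H * (exp t * exp (- t)) ^ n"
    by (simp only: power_mult_distrib mult_ac)
  finally show "fact n * (d / n) ^ n * ((1 - 3 / q) * exp (- t)) ^ n \<le> ?H"
    by (simp add: power_mult_distrib exp_minus_inverse mult.assoc)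
  have "fact n * (d / n) ^ n * (1 + 3 / q) ^ n * real (n + 1) ^ E \<le> fact n * (d / n) ^ n * (1 + 3 / q) ^ n * exp t ^ n"
    using tE d_pos q3 by (intro mult_left_mono) auto
  with b(2) have "?H \<le> fact n * (d / n) ^ n * (1 + 3 / q) ^ n * exp t ^ n" by (rule order.trans)
  then show "?H \<le> fact n * (d / n) ^ n * ((1 + 3 / q) * exp t) ^ n"
    by (simp add: power_mult_distrib mult.assoc)
qed

theorem theorem6:
  fixes G :: "nat \<Rightarrow> nat \<Rightarrow> nat \<Rightarrow> bool"
    and lam :: "nat \<Rightarrow> real"
    and R :: real
  assumes graphs: "\<And>n. simple_graph_on n (G n)"
    and lam_pos: "\<And>n. lam n > 0"
    and spectral: "\<And>n. \<forall>x \<in># nontrivial_eigenvalues n (G n). \<bar>x\<bar> \<le> lam n"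
    and R_pos: "R > 0"
    and cond1: "\<And>n. n \<ge> 1 \<Longrightarrow>
                  real (max_degree n (G n)) - real (min_degree n (G n)) \<le> R * lam n"
    and cond2: "filterlim (\<lambda>n. (avg_degree n (G n) / lam n) / (ln (real n))\<^sup>2) at_top sequentially"
    and cond3: "filterlim (\<lambda>n. ln (avg_degree n (G n)) * ln (avg_degree n (G n) / lam n) / ln (real n))
                  at_top sequentially"
  shows "\<exists>\<epsilon> :: nat \<Rightarrow> real. \<epsilon> \<longlonglongrightarrow> 0 \<and>
           (\<forall>\<^sub>F n in sequentially.
              fact n * (avg_degree n (G n) / real n) ^ n * (1 - \<epsilon> n) ^ n
                \<le> real (num_hamilton_cycles n (G n)) \<and>
              real (num_hamilton_cycles n (G n))
                \<le> fact n * (avg_degree n (G n) / real n) ^ n * (1 + \<epsilon> n) ^ n)"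
proof -
  define d where "d n = avg_degree n (G n)" for n
  define C where "C = 2 * R + 1 + (R + 1)\<^sup>2"
  have C: "C \<ge> 1" using R_pos by (simp add: C_def)
  \<comment> \<open>Solves \<open>d = q\<^sup>2 * \<mu> * (ln n)\<^sup>2\<close> for
    \<open>\<mu> = C * lam n\<close>; the growth of \<open>d / lam\<close> over the squared
    logarithm sends it to infinity.\<close>
  define q where "q n = sqrt (d n / (C * lam n) / (ln (real n))\<^sup>2)" for n
  define t where "t n = 200 * (1 / q n + (ln (real n))\<^sup>2 / real n)" for n
  \<comment> \<open>The maximum makes one sequence serve both the lower and the upper bound.\<close>
  define \<epsilon> where "\<epsilon> n = max (1 - (1 - 3 / q n) * exp (- t n)) ((1 + 3 / q n) * exp (t n) - 1)" for n
  have "filterlim (\<lambda>n. (1 / C) * (d n / lam n / (ln (real n))\<^sup>2)) at_top sequentially"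
    using cond2 C unfolding d_def by (intro filterlim_tendsto_pos_mult_at_top[OF tendsto_const]) auto
  then have "filterlim (\<lambda>n. d n / (C * lam n) / (ln (real n))\<^sup>2) at_top sequentially"
    by (simp add: mult_ac)
  then have q: "filterlim q at_top sequentially"
    unfolding q_def by (rule filterlim_compose[OF sqrt_at_top])
  have q0: "(\<lambda>n. 1 / q n) \<longlonglongrightarrow> 0"
    using filterlim_compose[OF tendsto_inverse_0_at_top q] tendsto_inverse_0_at_top[OF q]
    by (simp add: inverse_eq_divide)
  have "(\<lambda>n. (ln (real n))\<^sup>2 / real n) \<longlonglongrightarrow> 0" by real_asymp
  then have "(\<lambda>n. 200 * (1 / q n + (ln (real n))\<^sup>2 / real n)) \<longlonglongrightarrow> 200 * (0 + 0)"
    by (intro tendsto_intros q0)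
  then have t0: "t \<longlonglongrightarrow> 0" unfolding t_def by simp
  have q3: "(\<lambda>n. 3 / q n) \<longlonglongrightarrow> 0" using tendsto_mult_right[OF q0, of 3] by simp
  have "(\<lambda>n. 1 - (1 - 3 / q n) * exp (- t n)) \<longlonglongrightarrow> 1 - (1 - 0) * exp (- 0)"
    by (intro tendsto_intros q3 t0)
  moreover have "(\<lambda>n. (1 + 3 / q n) * exp (t n) - 1) \<longlonglongrightarrow> (1 + 0) * exp 0 - 1"
    by (intro tendsto_intros q3 t0)
  ultimately have eps: "\<epsilon> \<longlonglongrightarrow> 0"
    unfolding \<epsilon>_def using tendsto_max by fastforce
  \<comment> \<open>Needed so that \<open>1 - \<epsilon> n\<close> is nonnegative before taking
    powers.\<close>
  have ev1: "\<forall>\<^sub>F n in sequentially. \<epsilon> n < 1" using eps by (rule order_tendstoD) simp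
  have ev2: "\<forall>\<^sub>F n in sequentially. q n \<ge> 1000" using q by (simp add: filterlim_at_top)
  have ev3: "\<forall>\<^sub>F n in sequentially. real n \<ge> 200 * ln (real n)" by real_asymp
  have "\<forall>\<^sub>F n in sequentially.
      fact n * (d n / real n) ^ n * (1 - \<epsilon> n) ^ n \<le> real (num_hamilton_cycles n (G n)) \<and>
      real (num_hamilton_cycles n (G n)) \<le> fact n * (d n / real n) ^ n * (1 + \<epsilon> n) ^ n"
    using ev1 ev2 ev3 eventually_ge_at_top[of 3]
  proof eventually_elim
    case (elim n)
    have "exp 1 \<le> (3 :: real)" by (rule exp_le)
    then have L1: "1 \<le> ln (real n)" using elim by (subst ln_ge_iff) auto
    have pos: "0 < C * lam n" using C lam_pos[of n] by simp
    \<comment> \<open>The real square root of a negative number is negative, so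
      \<open>q n \<ge> 1000\<close> forces the radicand to be nonnegative.\<close>
    have q2pos: "0 \<le> d n / (C * lam n) / (ln (real n))\<^sup>2"
      using elim(2) unfolding q_def by (smt (verit) real_sqrt_lt_0_iff)
    then have q2: "(q n)\<^sup>2 = d n / (C * lam n) / (ln (real n))\<^sup>2" by (simp add: q_def)
    then have dq: "d n = (q n)\<^sup>2 * (C * lam n * (ln (real n))\<^sup>2)" using pos L1 C lam_pos[of n] by (simp add: field_simps)
    have "1000 * 1000 \<le> q n * q n" using elim(2) by (intro mult_mono) auto
    then have "2 * 1 \<le> (q n)\<^sup>2 * (ln (real n))\<^sup>2"
      using L1 by (intro mult_mono) (auto simp: power2_eq_square mult_ge1_I)
    then have "C * lam n * 2 \<le> C * lam n * ((q n)\<^sup>2 * (ln (real n))\<^sup>2)" using pos by (intro mult_left_mono) auto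
    then have d2: "2 * (C * lam n) \<le> d n" by (simp add: dq mult_ac)
    have "1 * lam n \<le> C * lam n" "R * lam n \<le> C * lam n"
      using C R_pos lam_pos[of n] by (auto intro!: mult_right_mono simp: C_def)
    then have dl: "2 * lam n \<le> avg_degree n (G n)" "2 * R * lam n \<le> avg_degree n (G n)"
      using d2 unfolding d_def by linarith+
    interpret pseudorandom n "G n" "d n" "C * lam n"
      unfolding d_def C_def
      by (rule pseudorandom_of_spectrum[OF graphs _ spectral lam_pos R_pos cond1 dl]) (use elim in auto)
    have "degree_of n (G n) i \<le> n" for i
      unfolding degree_of_def by (rule order.trans[OF card_mono[of "{..<n}"]]) auto
    then have "(\<Sum>i<n. real (degree_of n (G n) i)) \<le> (\<Sum>i<n. real n)" by (intro sum_mono) simp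
    then have dn: "d n \<le> n" using n_pos by (simp add: d_def avg_degree_def field_simps)
    note b = hamilton_cycle_count_exp[OF elim(4,3) dn elim(2) dq, folded t_def]
    have "fact n * (d n / n) ^ n * (1 - \<epsilon> n) ^ n \<le> fact n * (d n / n) ^ n * ((1 - 3 / q n) * exp (- t n)) ^ n"
      using elim(1) d_pos by (intro mult_left_mono power_mono) (auto simp: \<epsilon>_def)
    moreover have "fact n * (d n / n) ^ n * ((1 + 3 / q n) * exp (t n)) ^ n \<le> fact n * (d n / n) ^ n * (1 + \<epsilon> n) ^ n"
      using elim(2) d_pos by (intro mult_left_mono power_mono) (auto simp: \<epsilon>_def)
    ultimately show ?case using b by linarith
  qed
  then show ?thesis using eps unfolding d_def by blast
qed

end
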